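(* If a time-like $2$-regular curve $\gamma$ in $\mathbb{L}^4$ admits a generalized Bishop frame of type F, then it also admits generalized Bishop frames of all the other types B, C and D. In particular, if $\gamma$ admits the Frenet frame, then it admits generalized Bishop frames of all other types (B, C and D).
   Context: $\mathbb{L}^4$ is $\mathbb{R}^4$ with the Lorentzian inner product $\langle\cdot,\cdot\rangle$ of signature $(-,+,+,+)$. Curves $\gamma: I\to\mathbb{L}^4$ are smooth and defined on an open interval $I$. A regular time-like curve is one with $\langle\gamma',\gamma'\rangle<0$ everywhere. It is parametrized by proper time $s$, so that $\mathbb{T}=\gamma'$ satisfies $\langle\mathbb{T},\mathbb{T}\rangle=-1$, and $'$ denotes $d/ds$. A time-like curve is called $2$-regular if both its tangent vector $\mathbb{T}$ and the derivative $\mathbb{T}'$ are nowhere zero. An orthonormal frame of $\gamma$ is a smooth family $\{\mathbb{T},\mathbb{Z}_1,\mathbb{Z}_2,\mathbb{Z}_3\}$ along $\gamma$ whose first vector is $\mathbb{T}$, with $\langle\mathbb{T},\mathbb{Z}_i\rangle=0$ and $\langle\mathbb{Z}_i,\mathbb{Z}_j\rangle=\delta_{ij}$. Writing $\mathbb{Z}$ for the matrix with rows $\mathbb{T},\mathbb{Z}_1,\mathbb{Z}_2,\mathbb{Z}_3$, its coefficient matrix is the matrix-valued function $X$ with $\mathbb{Z}'=X\mathbb{Z}$. The frame is called a generalized Bishop frame of type B, C, D, F respectively if, after some permutation of the last three vectors, its coefficient matrix has the respective form below for some smooth functions $x_1,x_2,x_3$ on $I$ (zeros allowed): $$\text{B}:\begin{pmatrix}0&x_1&x_2&x_3\\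 x_1&0&0&0\\ x_2&0&0&0\\ x_3&0&0&0\end{pmatrix},\quad\text{C}:\begin{pmatrix}0&x_1&x_2&0\\ x_1&0&0&x_3\\ x_2&0&0&0\\ 0&-x_3&0&0\end{pmatrix},$$ $$\text{D}:\begin{pmatrix}0&x_1&0&0\\ x_1&0&x_2&x_3\\ 0&-x_2&0&0\\ 0&-x_3&0&0\end{pmatrix},\quad \text{F}:\begin{pmatrix}0&x_1&0&0\\ x_1&0&x_2&0\\ 0&-x_2&0&x_3\\ 0&0&-x_3&0\end{pmatrix}.$$ A Frenet frame is an orthonormal frame whose coefficient matrix has the displayed form F with $x_1>0$ and $x_2>0$ on $I$. *)

theory Defs
  imports "HOL-Analysis.Analysis"
begin

text \<open>Lorentz-Minkowski space is \<open>real^4\<close> with the inner product of signature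
  \<open>(-,+,+,+)\<close>. The index type \<open>4\<close> has the elements \<open>1, 2, 3, 4\<close> (where \<open>4 = 0\<close>); the matrix
  \<open>A :: real^4^4\<close> has rows \<open>A $ i\<close>.\<close>

lemma vector_4:
  fixes a b c d :: "'a::zero"
  shows "(vector [a, b, c, d] :: 'a^4) $ 1 = a" "(vector [a, b, c, d] :: 'a^4) $ 2 = b"
    "(vector [a, b, c, d] :: 'a^4) $ 3 = c" "(vector [a, b, c, d] :: 'a^4) $ 4 = d"
  by (simp_all add: vector_def)

definition lorentz :: "real^4 \<Rightarrow> real^4 \<Rightarrow> real" where
  "lorentz x y = - (x $ 1 * y $ 1) + x $ 2 * y $ 2 + x $ 3 * y $ 3 + x $ 4 * y $ 4"

text \<open>The derivatives are two-sided, so this is the usual notion when \<open>I\<close> is open; it then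
  depends only on the values of \<open>f\<close> on \<open>I\<close>.\<close>

definition smooth_on :: "real set \<Rightarrow> (real \<Rightarrow> 'a::real_normed_vector) \<Rightarrow> bool" where
  "smooth_on I f \<longleftrightarrow>
     (\<forall>n. \<forall>t\<in>I. ((\<lambda>g u. vector_derivative g (at u)) ^^ n) f differentiable (at t))"

definition tangent :: "(real \<Rightarrow> real^4) \<Rightarrow> real \<Rightarrow> real^4" where
  "tangent \<gamma> t = vector_derivative \<gamma> (at t)"

definition timelike_curve :: "real set \<Rightarrow> (real \<Rightarrow> real^4) \<Rightarrow> bool" where
  "timelike_curve I \<gamma> \<longleftrightarrow>
     smooth_on I \<gamma> \<and> (\<forall>t\<in>I. lorentz (tangent \<gamma> t) (tangent \<gamma> t) < 0)"

definition proper_time :: "real set \<Rightarrow> (real \<Rightarrow> real^4) \<Rightarrow> bool" where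
  "proper_time I \<gamma> \<longleftrightarrow> (\<forall>t\<in>I. lorentz (tangent \<gamma> t) (tangent \<gamma> t) = -1)"

definition two_regular :: "real set \<Rightarrow> (real \<Rightarrow> real^4) \<Rightarrow> bool" where
  "two_regular I \<gamma> \<longleftrightarrow>
     (\<forall>t\<in>I. tangent \<gamma> t \<noteq> 0 \<and> vector_derivative (tangent \<gamma>) (at t) \<noteq> 0)"

definition orthonormal_frame ::
    "real set \<Rightarrow> (real \<Rightarrow> real^4) \<Rightarrow> (real \<Rightarrow> real^4^4) \<Rightarrow> bool" where
  "orthonormal_frame I \<gamma> Z \<longleftrightarrow>
     smooth_on I Z \<and>
     (\<forall>t\<in>I. Z t $ 1 = tangent \<gamma> t \<and>
        (\<forall>i\<in>{2,3,4}. lorentz (tangent \<gamma> t) (Z t $ i) = 0) \<and>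
        (\<forall>i\<in>{2,3,4}. \<forall>j\<in>{2,3,4}. lorentz (Z t $ i) (Z t $ j) = (if i = j then 1 else 0)))"

definition coefficient_matrix ::
    "real set \<Rightarrow> (real \<Rightarrow> real^4^4) \<Rightarrow> (real \<Rightarrow> real^4^4) \<Rightarrow> bool" where
  "coefficient_matrix I Z X \<longleftrightarrow> (\<forall>t\<in>I. (Z has_vector_derivative (X t ** Z t)) (at t))"

definition form_B :: "real \<Rightarrow> real \<Rightarrow> real \<Rightarrow> real^4^4" where
  "form_B x1 x2 x3 = vector
     [vector [0,  x1, x2, x3],
      vector [x1, 0,  0,  0],
      vector [x2, 0,  0,  0],
      vector [x3, 0,  0,  0]]"

definition form_C :: "real \<Rightarrow> real \<Rightarrow> real \<Rightarrow> real^4^4" where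
  "form_C x1 x2 x3 = vector
     [vector [0,  x1,  x2, 0],
      vector [x1, 0,   0,  x3],
      vector [x2, 0,   0,  0],
      vector [0,  -x3, 0,  0]]"

definition form_D :: "real \<Rightarrow> real \<Rightarrow> real \<Rightarrow> real^4^4" where
  "form_D x1 x2 x3 = vector
     [vector [0,  x1,  0,  0],
      vector [x1, 0,   x2, x3],
      vector [0,  -x2, 0,  0],
      vector [0,  -x3, 0,  0]]"

definition form_F :: "real \<Rightarrow> real \<Rightarrow> real \<Rightarrow> real^4^4" where
  "form_F x1 x2 x3 = vector
     [vector [0,  x1,  0,   0],
      vector [x1, 0,   x2,  0],
      vector [0,  -x2, 0,   x3],
      vector [0,  0,   -x3, 0]]"

text \<open>A permutation of \<open>{2,3,4}\<close> fixes the index \<open>1\<close>, i.e. the tangent row.\<close>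

definition bishop_frame ::
    "(real \<Rightarrow> real \<Rightarrow> real \<Rightarrow> real^4^4) \<Rightarrow> real set \<Rightarrow> (real \<Rightarrow> real^4) \<Rightarrow> (real \<Rightarrow> real^4^4) \<Rightarrow> bool"
  where
  "bishop_frame form I \<gamma> Z \<longleftrightarrow>
     orthonormal_frame I \<gamma> Z \<and>
     (\<exists>p x1 x2 x3. p permutes {2, 3, 4} \<and> smooth_on I x1 \<and> smooth_on I x2 \<and> smooth_on I x3 \<and>
        coefficient_matrix I (\<lambda>t. \<chi> i. Z t $ p i) (\<lambda>t. form (x1 t) (x2 t) (x3 t)))"

definition admits_bishop_frame ::
    "(real \<Rightarrow> real \<Rightarrow> real \<Rightarrow> real^4^4) \<Rightarrow> real set \<Rightarrow> (real \<Rightarrow> real^4) \<Rightarrow> bool" where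
  "admits_bishop_frame form I \<gamma> \<longleftrightarrow> (\<exists>Z. bishop_frame form I \<gamma> Z)"

definition frenet_frame ::
    "real set \<Rightarrow> (real \<Rightarrow> real^4) \<Rightarrow> (real \<Rightarrow> real^4^4) \<Rightarrow> bool" where
  "frenet_frame I \<gamma> Z \<longleftrightarrow>
     orthonormal_frame I \<gamma> Z \<and>
     (\<exists>x1 x2 x3. smooth_on I x1 \<and> smooth_on I x2 \<and> smooth_on I x3 \<and>
        (\<forall>t\<in>I. x1 t > 0 \<and> x2 t > 0) \<and>
        coefficient_matrix I Z (\<lambda>t. form_F (x1 t) (x2 t) (x3 t)))"

definition admits_frenet_frame :: "real set \<Rightarrow> (real \<Rightarrow> real^4) \<Rightarrow> bool" where
  "admits_frenet_frame I \<gamma> \<longleftrightarrow> (\<exists>Z. frenet_frame I \<gamma> Z)"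

end

theory Submission
  imports Defs
begin

text \<open>
The coefficient matrix of an orthonormal frame is determined by six functions
\<open>\<omega> i j = \<langle>Z i', Z j\<rangle>\<close>, \<open>i < j\<close>, and a frame is of type B, C or D when three prescribed ones
among them vanish (\<open>frame_equations\<close>, \<open>bishop_frameI\<close>). So in each case the space-like
vectors of some known frame have to be rotated suitably.

Type D: in a frame of type F one coefficient is in excess, namely the speed \<open>x3\<close> of rotation in the
plane of the last two vectors. It is cancelled by rotating that plane by a primitive of \<open>- x3\<close>.

Type B: all mutual rotation of the space-like vectors has to be cancelled. The orthonormal basis
that the given frame provides at one point is extended by Fermi-Walker transport
\<open>w' = \<langle>w, T'\<rangle> T - \<langle>w, T\<rangle> T'\<close>, a linear equation that can be solved along the entire interval
(\<open>linear_ode_solution\<close>), preserves the Lorentz product and has \<open>T\<close> among its solutions. The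
transported vectors therefore form an orthonormal frame with \<open>w'\<close> proportional to \<open>T\<close>.

Type C: let \<open>k\<close> be the curve in three-space formed by the coordinates of \<open>T'\<close> in a type B frame. It
has no zero because the curve is 2-regular. The lines through the origin that meet \<open>k\<close> form a null
set (\<open>exists_direction_off_curve\<close>), so there is a constant unit vector \<open>c\<close> that is nowhere
parallel to \<open>k\<close>. Then \<open>T\<close>, \<open>n \<times> c\<close>, \<open>c\<close>, \<open>n\<close> with \<open>n\<close> the unit vector along \<open>k \<times> c\<close> is a frame
of type C: \<open>c\<close> still has a derivative proportional to \<open>T\<close>, and \<open>n\<close> is orthogonal to \<open>T'\<close>.

A Frenet frame is in particular a frame of type F.
\<close>

section \<open>Calculus of smooth functions on an open set\<close>

text \<open>\<open>n\<close>-fold differentiability, with the derivative left existential. Closure properties of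
smooth functions then become inductions on \<open>n\<close> in which the derivative is whatever the
product or chain rule delivers, and no iterated derivative has to be computed.\<close>
primrec diff_upto :: "nat \<Rightarrow> real set \<Rightarrow> (real \<Rightarrow> 'a::real_normed_vector) \<Rightarrow> bool" where
  "diff_upto 0 I f \<longleftrightarrow> True"
| "diff_upto (Suc n) I f \<longleftrightarrow>
     (\<exists>f'. (\<forall>t\<in>I. (f has_vector_derivative f' t) (at t)) \<and> diff_upto n I f')"

lemma diff_upto_SucI:
  assumes "\<And>t. t \<in> I \<Longrightarrow> (f has_vector_derivative f' t) (at t)" "diff_upto n I f'"
  shows "diff_upto (Suc n) I f"
  unfolding diff_upto.simps by (intro exI[of _ f'] conjI ballI assms)

lemma diff_upto_SucD: "diff_upto (Suc n) I f \<Longrightarrow> diff_upto n I f"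
proof (induction n arbitrary: f)
  case (Suc n)
  then obtain f' where "\<forall>t\<in>I. (f has_vector_derivative f' t) (at t)" "diff_upto (Suc n) I f'"
    by auto
  then show ?case using Suc.IH[of f'] by auto
qed simp

lemma has_vector_derivative_cong_open:
  assumes "open I" "t \<in> I" "\<And>s. s \<in> I \<Longrightarrow> f s = g s"
  shows "(f has_vector_derivative d) (at t) \<longleftrightarrow> (g has_vector_derivative d) (at t)"
  using has_vector_derivative_transform_within_open[OF _ assms(1,2), of f d g]
    has_vector_derivative_transform_within_open[OF _ assms(1,2), of g d f] assms(3) by auto

lemma diff_upto_cong:
  assumes "open I" "\<And>s. s \<in> I \<Longrightarrow> f s = g s"
  shows "diff_upto n I f \<longleftrightarrow> diff_upto n I g"
proof (cases n)
  case (Suc m)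
  have "(f has_vector_derivative f' t) (at t) \<longleftrightarrow> (g has_vector_derivative f' t) (at t)"
    if "t \<in> I" for t f'
    by (rule has_vector_derivative_cong_open[OF assms(1) that assms(2)])
  then show ?thesis using Suc by simp
qed simp

lemma diff_upto_Suc_iff:
  assumes "open I"
  shows "diff_upto (Suc n) I f \<longleftrightarrow>
    (\<forall>t\<in>I. f differentiable (at t)) \<and> diff_upto n I (\<lambda>t. vector_derivative f (at t))"
proof
  assume "diff_upto (Suc n) I f"
  then obtain f' where f': "\<And>t. t \<in> I \<Longrightarrow> (f has_vector_derivative f' t) (at t)"
    "diff_upto n I f'" by auto
  then have "\<And>t. t \<in> I \<Longrightarrow> f' t = vector_derivative f (at t)"
    by (metis vector_derivative_at)
  from diff_upto_cong[where f = f', OF assms this] f'(2) have "diff_upto n I (\<lambda>t. vector_derivative f (at t))"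
    by blast
  with f' show "(\<forall>t\<in>I. f differentiable (at t)) \<and> diff_upto n I (\<lambda>t. vector_derivative f (at t))"
    by (blast intro: differentiableI_vector)
next
  assume "(\<forall>t\<in>I. f differentiable (at t)) \<and> diff_upto n I (\<lambda>t. vector_derivative f (at t))"
  then show "diff_upto (Suc n) I f"
    by (intro diff_upto_SucI[where f' = "\<lambda>t. vector_derivative f (at t)"])
      (simp_all flip: vector_derivative_works)
qed

text \<open>\<open>diff_upto n\<close> asks only that the iterated derivatives of order below \<open>n\<close> be differentiable,
so the two notions agree once \<open>n\<close> is unbounded. Openness is what makes the derivative at a
point of \<open>I\<close> independent of the values outside \<open>I\<close>.\<close>
lemma smooth_on_iff_diff_upto:
  assumes "open I"
  shows "smooth_on I f \<longleftrightarrow> (\<forall>n. diff_upto n I f)"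
proof -
  let ?D = "\<lambda>g u. vector_derivative g (at u)"
  have "diff_upto n I f \<longleftrightarrow> (\<forall>m<n. \<forall>t\<in>I. (?D ^^ m) f differentiable (at t))" for n
  proof (induction n arbitrary: f)
    case (Suc n)
    show ?case
      by (simp add: diff_upto_Suc_iff[OF assms] Suc.IH All_less_Suc2 funpow_Suc_right del: funpow.simps diff_upto.simps)
  qed simp
  then show ?thesis
    unfolding smooth_on_def by auto
qed

lemma diff_upto_const [simp]: "diff_upto n I (\<lambda>t. c)"
proof (induction n arbitrary: c)
  case (Suc n)
  then show ?case by (auto intro!: exI[of _ "\<lambda>t. 0"])
qed simp

lemma diff_upto_bounded_linear:
  assumes "bounded_linear h"
  shows "diff_upto n I f \<Longrightarrow> diff_upto n I (\<lambda>t. h (f t))"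
proof (induction n arbitrary: f)
  case (Suc n)
  then obtain f' where "\<And>t. t \<in> I \<Longrightarrow> (f has_vector_derivative f' t) (at t)" "diff_upto n I f'"
    unfolding diff_upto.simps by blast
  with Suc.IH[of f'] show ?case
    by (auto intro!: exI[where x = "\<lambda>t. h (f' t)"] bounded_linear.has_vector_derivative[OF assms])
qed simp

lemma diff_upto_add: "diff_upto n I f \<Longrightarrow> diff_upto n I g \<Longrightarrow> diff_upto n I (\<lambda>t. f t + g t)"
proof (induction n arbitrary: f g)
  case (Suc n)
  then obtain f' g' where "\<And>t. t \<in> I \<Longrightarrow> (f has_vector_derivative f' t) (at t)" "diff_upto n I f'"
    "\<And>t. t \<in> I \<Longrightarrow> (g has_vector_derivative g' t) (at t)" "diff_upto n I g'"
    unfolding diff_upto.simps by blast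
  with Suc.IH show ?case
    by (auto intro!: exI[where x = "\<lambda>t. f' t + g' t"] has_vector_derivative_add)
qed simp

lemma diff_upto_bounded_bilinear:
  assumes "bounded_bilinear h"
  shows "diff_upto n I f \<Longrightarrow> diff_upto n I g \<Longrightarrow> diff_upto n I (\<lambda>t. h (f t) (g t))"
proof (induction n arbitrary: f g)
  case (Suc n)
  then obtain f' g' where fg: "\<And>t. t \<in> I \<Longrightarrow> (f has_vector_derivative f' t) (at t)" "diff_upto n I f'"
    "\<And>t. t \<in> I \<Longrightarrow> (g has_vector_derivative g' t) (at t)" "diff_upto n I g'"
    unfolding diff_upto.simps by blast
  have "diff_upto n I (\<lambda>t. h (f t) (g' t) + h (f' t) (g t))"
    by (intro diff_upto_add Suc.IH fg diff_upto_SucD[OF Suc.prems(1)] diff_upto_SucD[OF Suc.prems(2)])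
  with fg show ?case
    by (auto intro!: exI[where x = "\<lambda>t. h (f t) (g' t) + h (f' t) (g t)"]
        bounded_bilinear.has_vector_derivative[OF assms])
qed simp

lemma smooth_on_const: "open I \<Longrightarrow> smooth_on I (\<lambda>t. c)"
  by (simp add: smooth_on_iff_diff_upto)

lemma smooth_on_add:
  "open I \<Longrightarrow> smooth_on I f \<Longrightarrow> smooth_on I g \<Longrightarrow> smooth_on I (\<lambda>t. f t + g t)"
  by (simp add: smooth_on_iff_diff_upto diff_upto_add)

lemma smooth_on_bounded_linear:
  "bounded_linear h \<Longrightarrow> open I \<Longrightarrow> smooth_on I f \<Longrightarrow> smooth_on I (\<lambda>t. h (f t))"
  by (simp add: smooth_on_iff_diff_upto diff_upto_bounded_linear)

lemma smooth_on_bounded_bilinear: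
  "bounded_bilinear h \<Longrightarrow> open I \<Longrightarrow> smooth_on I f \<Longrightarrow> smooth_on I g
    \<Longrightarrow> smooth_on I (\<lambda>t. h (f t) (g t))"
  by (simp add: smooth_on_iff_diff_upto diff_upto_bounded_bilinear)

lemmas smooth_on_minus = smooth_on_bounded_linear[OF bounded_linear_minus[OF bounded_linear_ident]]
lemmas smooth_on_scaleR = smooth_on_bounded_bilinear[OF bounded_bilinear_scaleR]
lemmas smooth_on_inner = smooth_on_bounded_bilinear[OF bounded_bilinear_inner]
lemmas smooth_on_vec_nth = smooth_on_bounded_linear[OF bounded_linear_vec_nth]

text \<open>In this form the smoothness of a primitive, and hence of a rotation angle, is inherited from the
integrand.\<close>
lemma smooth_on_derivative_iff:
  assumes "open I" "\<And>t. t \<in> I \<Longrightarrow> (f has_vector_derivative f' t) (at t)"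
  shows "smooth_on I f \<longleftrightarrow> smooth_on I f'"
proof -
  have "diff_upto (Suc n) I f \<longleftrightarrow> diff_upto n I f'" for n
  proof -
    have "diff_upto n I (\<lambda>t. vector_derivative f (at t)) \<longleftrightarrow> diff_upto n I f'"
      by (rule diff_upto_cong[OF assms(1)]) (simp add: assms(2) vector_derivative_at)
    then show ?thesis
      unfolding diff_upto_Suc_iff[OF assms(1)] using assms(2) by (blast intro: differentiableI_vector)
  qed
  then show ?thesis
    unfolding smooth_on_iff_diff_upto[OF assms(1)] using diff_upto_SucD by blast
qed

lemma smooth_on_has_vector_derivative:
  assumes "open I" "smooth_on I f" "t \<in> I"
  shows "(f has_vector_derivative vector_derivative f (at t)) (at t)"
  using assms diff_upto_Suc_iff[of I 0 f] vector_derivative_works smooth_on_iff_diff_upto by blast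

lemma smooth_on_vector_derivative:
  assumes "open I" "smooth_on I f"
  shows "smooth_on I (\<lambda>t. vector_derivative f (at t))"
  using smooth_on_derivative_iff[OF assms(1) smooth_on_has_vector_derivative[OF assms]] assms(2)
  by blast

lemma smooth_on_continuous_on:
  assumes "open I" "smooth_on I f"
  shows "continuous_on I f"
  using smooth_on_has_vector_derivative[OF assms]
  by (meson continuous_at_imp_continuous_on has_vector_derivative_continuous)

text \<open>Bootstrapping: when \<open>f'\<close> is as regular as \<open>f\<close> itself, every order of differentiability of
\<open>f\<close> yields one more. It covers reciprocals and square roots, whose derivatives involve the
function again, as well as solutions of linear differential equations.\<close>
lemma smooth_on_self_derivative:
  assumes "open I" "\<And>t. t \<in> I \<Longrightarrow> (f has_vector_derivative f' t) (at t)"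
    and "\<And>n. diff_upto n I f \<Longrightarrow> diff_upto n I f'"
  shows "smooth_on I f"
proof -
  have "diff_upto n I f" for n
    by (induction n) (use assms(2,3) in auto)
  then show ?thesis by (simp add: smooth_on_iff_diff_upto assms(1))
qed

lemma smooth_on_inverse:
  fixes f :: "real \<Rightarrow> real"
  assumes "open I" "smooth_on I f" "\<And>t. t \<in> I \<Longrightarrow> f t \<noteq> 0"
  shows "smooth_on I (\<lambda>t. inverse (f t))"
proof (rule smooth_on_self_derivative[OF assms(1)])
  let ?f' = "\<lambda>t. vector_derivative f (at t)"
  fix t assume t: "t \<in> I"
  have "(f has_field_derivative ?f' t) (at t)"
    using smooth_on_has_vector_derivative[OF assms(1,2) t]
    by (simp add: has_real_derivative_iff_has_vector_derivative)
  from DERIV_inverse_fun[OF this assms(3)[OF t]]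
  show "((\<lambda>t. inverse (f t)) has_vector_derivative - ?f' t * (inverse (f t) * inverse (f t))) (at t)"
    by (simp add: has_real_derivative_iff_has_vector_derivative power2_eq_square mult_ac)
next
  fix n assume "diff_upto n I (\<lambda>t. inverse (f t))"
  moreover have "diff_upto n I (\<lambda>t. - vector_derivative f (at t))"
    using smooth_on_minus[OF assms(1) smooth_on_vector_derivative[OF assms(1,2)]] assms(1)
    by (simp add: smooth_on_iff_diff_upto)
  ultimately show "diff_upto n I
      (\<lambda>t. - vector_derivative f (at t) * (inverse (f t) * inverse (f t)))"
    by (intro diff_upto_bounded_bilinear[OF bounded_bilinear_mult])
qed

lemma smooth_on_sqrt:
  fixes f :: "real \<Rightarrow> real"
  assumes "open I" "smooth_on I f" "\<And>t. t \<in> I \<Longrightarrow> f t > 0"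
  shows "smooth_on I (\<lambda>t. sqrt (f t))"
proof (rule smooth_on_self_derivative[OF assms(1)])
  let ?f' = "\<lambda>t. vector_derivative f (at t)"
  fix t assume t: "t \<in> I"
  have *: "(f has_field_derivative ?f' t) (at t)"
    using smooth_on_has_vector_derivative[OF assms(1,2) t]
    by (simp add: has_real_derivative_iff_has_vector_derivative)
  show "((\<lambda>t. sqrt (f t)) has_vector_derivative ?f' t * (1/2 * (inverse (f t) * sqrt (f t)))) (at t)"
    unfolding has_real_derivative_iff_has_vector_derivative[symmetric]
    using assms(3)[OF t]
    by (auto intro!: derivative_eq_intros * simp: field_simps)
next
  fix n assume "diff_upto n I (\<lambda>t. sqrt (f t))"
  moreover have "diff_upto n I (\<lambda>t. vector_derivative f (at t))"
    using smooth_on_vector_derivative[OF assms(1,2)] assms(1)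
    by (simp add: smooth_on_iff_diff_upto)
  moreover have "diff_upto n I (\<lambda>t. inverse (f t))"
    using smooth_on_inverse[OF assms(1,2)] assms(3) assms(1)
    by (force simp: smooth_on_iff_diff_upto)
  ultimately show "diff_upto n I
      (\<lambda>t. vector_derivative f (at t) * (1/2 * (inverse (f t) * sqrt (f t))))"
    by (intro diff_upto_bounded_bilinear[OF bounded_bilinear_mult] diff_upto_const)
qed

text \<open>Cosine and sine are derivatives of one another up to the smooth factor \<open>\<theta>'\<close>, so both gain an
order of differentiability simultaneously.\<close>
lemma smooth_on_cos_sin:
  fixes \<theta> :: "real \<Rightarrow> real"
  assumes "open I" "smooth_on I \<theta>"
  shows "smooth_on I (\<lambda>t. cos (\<theta> t))" "smooth_on I (\<lambda>t. sin (\<theta> t))"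
proof -
  let ?d = "\<lambda>t. vector_derivative \<theta> (at t)"
  have *: "(\<theta> has_field_derivative ?d t) (at t)" if "t \<in> I" for t
    using smooth_on_has_vector_derivative[OF assms that]
    by (simp add: has_real_derivative_iff_has_vector_derivative)
  have d: "diff_upto n I ?d" for n
    using smooth_on_vector_derivative[OF assms] assms(1) by (simp add: smooth_on_iff_diff_upto)
  have "((\<lambda>t. cos (\<theta> t)) has_vector_derivative (-1 * (?d t * sin (\<theta> t)))) (at t)"
    "((\<lambda>t. sin (\<theta> t)) has_vector_derivative ?d t * cos (\<theta> t)) (at t)" if "t \<in> I" for t
    unfolding has_real_derivative_iff_has_vector_derivative[symmetric]
    by (auto intro!: derivative_eq_intros *[OF that] simp: mult_ac)
  note der = this
  have step: "diff_upto (Suc n) I (\<lambda>t. cos (\<theta> t)) \<and> diff_upto (Suc n) I (\<lambda>t. sin (\<theta> t))"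
    if "diff_upto n I (\<lambda>t. cos (\<theta> t))" "diff_upto n I (\<lambda>t. sin (\<theta> t))" for n
  proof -
    have "diff_upto n I (\<lambda>t. -1 * (?d t * sin (\<theta> t)))" "diff_upto n I (\<lambda>t. ?d t * cos (\<theta> t))"
      by (intro diff_upto_bounded_bilinear[OF bounded_bilinear_mult] diff_upto_const d that)+
    from diff_upto_SucI[OF der(1) this(1)] diff_upto_SucI[OF der(2) this(2)] show ?thesis ..
  qed
  have "diff_upto n I (\<lambda>t. cos (\<theta> t)) \<and> diff_upto n I (\<lambda>t. sin (\<theta> t))" for n
    by (induction n) (use step in auto)
  then show "smooth_on I (\<lambda>t. cos (\<theta> t))" "smooth_on I (\<lambda>t. sin (\<theta> t))"
    by (simp_all add: smooth_on_iff_diff_upto assms(1))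
qed

lemma has_vector_derivative_vec:
  fixes f :: "real \<Rightarrow> 'a::real_normed_vector ^ 'n"
  assumes "\<And>i. ((\<lambda>t. f t $ i) has_vector_derivative f' $ i) (at t within S)"
  shows "(f has_vector_derivative f') (at t within S)"
  unfolding has_vector_derivative_def has_derivative_at_within
proof
  show "((\<lambda>y. (f y - f t - (y - t) *\<^sub>R f') /\<^sub>R norm (y - t)) \<longlongrightarrow> 0) (at t within S)"
    using assms unfolding has_vector_derivative_def has_derivative_at_within
    by (intro vec_tendstoI) simp
qed (rule bounded_linear_scaleR_left)

lemma smooth_on_vec:
  fixes f :: "real \<Rightarrow> 'a::real_normed_vector ^ 'n"
  assumes "open I" "\<And>i. smooth_on I (\<lambda>t. f t $ i)"
  shows "smooth_on I f"
proof -
  have "diff_upto n I f" if "\<And>i. diff_upto n I (\<lambda>t. f t $ i)" for n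
    using that
  proof (induction n arbitrary: f)
    case (Suc n)
    then obtain f' where "\<And>i t. t \<in> I \<Longrightarrow> ((\<lambda>t. f t $ i) has_vector_derivative f' i t) (at t)"
      "\<And>i. diff_upto n I (f' i)" unfolding diff_upto.simps by metis
    with Suc.IH[of "\<lambda>t. \<chi> i. f' i t"] show ?case
      by (auto intro!: exI[of _ "\<lambda>t. \<chi> i. f' i t"] has_vector_derivative_vec)
  qed simp
  with assms(2) show ?thesis unfolding smooth_on_iff_diff_upto[OF assms(1)] by blast
qed

section \<open>Linear differential equations on an open interval\<close>

text \<open>The interval is rewritten with extended real endpoints, which allows unbounded intervals and
primitives that blow up at the boundary.\<close>
lemma antiderivative_on_open_interval:
  fixes g :: "real \<Rightarrow> 'a::euclidean_space"
  assumes "open I" "is_interval I" "continuous_on I g" "t0 \<in> I"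
  obtains G where "G t0 = v" "\<And>t. t \<in> I \<Longrightarrow> (G has_vector_derivative g t) (at t)"
proof -
  define a b where "a = (INF t\<in>I. ereal t)" "b = (SUP t\<in>I. ereal t)"
  have mem: "t \<in> I \<longleftrightarrow> a < ereal t \<and> ereal t < b" for t
  proof
    assume t: "t \<in> I"
    with \<open>open I\<close> obtain e where e: "e > 0" "cball t e \<subseteq> I"
      by (meson open_contains_cball)
    then have "t - e \<in> I" "t + e \<in> I" by (auto simp: dist_real_def subset_eq)
    with e show "a < ereal t \<and> ereal t < b"
      unfolding a_b_def INF_less_iff less_SUP_iff by (meson ereal_less_eq less_ereal.simps(1) diff_less_eq less_add_same_cancel1 not_le)
  next
    assume "a < ereal t \<and> ereal t < b"
    then obtain x y where "x \<in> I" "x < t" "y \<in> I" "t < y"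
      unfolding a_b_def INF_less_iff less_SUP_iff by auto
    with \<open>is_interval I\<close> show "t \<in> I"
      by (meson is_interval_1 less_imp_le)
  qed
  have "a < b" using \<open>t0 \<in> I\<close> mem less_trans by blast
  moreover have "isCont g x" if "a < ereal x" "ereal x < b" for x
    using that mem \<open>continuous_on I g\<close> \<open>open I\<close> continuous_on_eq_continuous_at by blast
  ultimately obtain F where "\<And>x. x \<in> I \<Longrightarrow> (F has_vector_derivative g x) (at x)"
    using einterval_antiderivative[of a b g] mem by blast
  then have "((\<lambda>t. F t + (v - F t0)) has_vector_derivative g t) (at t)" if "t \<in> I" for t
    using that by (simp add: has_vector_derivative_add_const)
  then show ?thesis by (intro that[of "\<lambda>t. F t + (v - F t0)"]) auto
qed

text \<open>The estimate behind the factorial decay of Picard iterates: integration raises the order of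
vanishing at \<open>t0\<close> by one and gains the factor \<open>1 / (n + 1)\<close>, to the left of \<open>t0\<close> as well as to
the right.\<close>
lemma norm_antiderivative_power_bound:
  fixes G :: "real \<Rightarrow> 'a::real_normed_vector"
  assumes der: "\<And>s. s \<in> closed_segment t0 t \<Longrightarrow> (G has_vector_derivative g s) (at s)"
    and "G t0 = 0"
    and bnd: "\<And>s. s \<in> closed_segment t0 t \<Longrightarrow> norm (g s) \<le> C * \<bar>s - t0\<bar> ^ n"
  shows "norm (G t) \<le> C * \<bar>t - t0\<bar> ^ Suc n / Suc n"
proof -
  have cont: "continuous_on (closed_segment t0 t) G"
    by (meson continuous_at_imp_continuous_on der has_vector_derivative_continuous)
  consider "t = t0" | "t0 < t" | "t < t0" by linarith
  then show ?thesis
  proof cases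
    case 1
    then show ?thesis using \<open>G t0 = 0\<close> by simp
  next
    case 2
    let ?\<phi> = "\<lambda>s. C * (s - t0) ^ Suc n / Suc n"
    have "norm (G t - G t0) \<le> ?\<phi> t - ?\<phi> t0"
    proof (rule differentiable_bound_general[where f' = g and \<phi>' = "\<lambda>s. C * (s - t0) ^ n"])
      fix s assume s: "t0 < s" "s < t"
      show "(?\<phi> has_vector_derivative C * (s - t0) ^ n) (at s)"
        unfolding has_real_derivative_iff_has_vector_derivative[symmetric]
        by (auto intro!: derivative_eq_intros simp del: power_Suc)
      show "(G has_vector_derivative g s) (at s)" "norm (g s) \<le> C * (s - t0) ^ n"
        using der[of s] bnd[of s] s by (auto simp: closed_segment_eq_real_ivl)
    qed (use 2 cont in \<open>auto simp: closed_segment_eq_real_ivl intro!: continuous_intros\<close>)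
    then show ?thesis using 2 \<open>G t0 = 0\<close> by simp
  next
    case 3
    let ?\<phi> = "\<lambda>s. - (C * (t0 - s) ^ Suc n / Suc n)"
    have "norm (G t0 - G t) \<le> ?\<phi> t0 - ?\<phi> t"
    proof (rule differentiable_bound_general[where f' = g and \<phi>' = "\<lambda>s. C * (t0 - s) ^ n"])
      fix s assume s: "t < s" "s < t0"
      show "(?\<phi> has_vector_derivative C * (t0 - s) ^ n) (at s)"
        unfolding has_real_derivative_iff_has_vector_derivative[symmetric]
        by (auto intro!: derivative_eq_intros simp del: power_Suc)
      show "(G has_vector_derivative g s) (at s)" "norm (g s) \<le> C * (t0 - s) ^ n"
        using der[of s] bnd[of s] s by (auto simp: closed_segment_eq_real_ivl)
    qed (use 3 cont in \<open>auto simp: closed_segment_eq_real_ivl intro!: continuous_intros\<close>)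
    then show ?thesis using 3 \<open>G t0 = 0\<close> by simp
  qed
qed

text \<open>A linear equation has a solution on the whole interval, not just near \<open>t0\<close>. The solution is the
sum \<open>y = \<Sum>n. Y n\<close> of the Picard increments \<open>Y 0 = y0\<close>, \<open>Y (n + 1) t = \<integral> A s (Y n s) ds\<close> over
\<open>[t0, t]\<close>. On a compact interval where \<open>norm (A s) \<le> M\<close> the increments are dominated by
\<open>norm y0 * (M * \<bar>t - t0\<bar>) ^ n / n!\<close>, so series and differentiated series converge uniformly.\<close>
lemma linear_ode_solution:
  fixes A :: "real \<Rightarrow> 'a::euclidean_space \<Rightarrow>\<^sub>L 'a"
  assumes "open I" "is_interval I" "t0 \<in> I" and contA: "continuous_on I A"
  obtains y where "y t0 = y0" "\<And>t. t \<in> I \<Longrightarrow> (y has_vector_derivative A t (y t)) (at t)"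
proof -
  have "\<exists>G. G t0 = 0 \<and> (\<forall>t\<in>I. (G has_vector_derivative g t) (at t))"
    if "continuous_on I g" for g :: "real \<Rightarrow> 'a"
    using antiderivative_on_open_interval[OF assms(1,2) that assms(3)] by metis
  then obtain P where P: "\<And>g :: real \<Rightarrow> 'a. continuous_on I g \<Longrightarrow>
      P g t0 = 0 \<and> (\<forall>t\<in>I. (P g has_vector_derivative g t) (at t))"
    by metis
  define Y where "Y = rec_nat (\<lambda>_. y0) (\<lambda>_ y. P (\<lambda>t. A t (y t)))"
  have Y0: "Y 0 = (\<lambda>_. y0)" and YS: "Y (Suc n) = P (\<lambda>t. A t (Y n t))" for n
    by (simp_all add: Y_def)
  have contY: "continuous_on I (Y n)" for n
  proof (induction n)
    case (Suc n)
    then have "continuous_on I (\<lambda>t. A t (Y n t))" by (intro continuous_intros contA)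
    from P[OF this] show ?case
      unfolding YS by (meson continuous_at_imp_continuous_on has_vector_derivative_continuous)
  qed (simp add: Y0)
  have YS0: "Y (Suc n) t0 = 0"
    and derY: "\<And>t. t \<in> I \<Longrightarrow> (Y (Suc n) has_vector_derivative A t (Y n t)) (at t)" for n
    using P[of "\<lambda>t. A t (Y n t)"] contY contA unfolding YS by (auto intro!: continuous_intros)
  define y where "y t = (\<Sum>n. Y n t)" for t
  have main: "(\<lambda>n. Y n t) sums y t \<and> (y has_vector_derivative A t (y t)) (at t)" if "t \<in> I" for t
  proof -
    \<comment> \<open>an open neighbourhood of both \<open>t\<close> and \<open>t0\<close> whose closure stays inside \<open>I\<close>, so that
      \<open>A\<close> is bounded on it and the series can be differentiated at \<open>t\<close>\<close>
    obtain e where e: "e > 0" "cball t e \<subseteq> I" "cball t0 e \<subseteq> I"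
    proof -
      obtain e1 e2 where "e1 > 0" "cball t e1 \<subseteq> I" "e2 > 0" "cball t0 e2 \<subseteq> I"
        using assms(1,3) \<open>t \<in> I\<close> by (meson open_contains_cball)
      then show ?thesis by (intro that[of "min e1 e2"]) auto
    qed
    define c d where "c = min t t0 - e" "d = max t t0 + e"
    have cd: "t \<in> {c<..<d}" "t0 \<in> {c<..<d}" using e(1) by (auto simp: c_d_def)
    have "c \<in> I" "d \<in> I"
      using e by (auto simp: c_d_def subset_eq dist_real_def min_def max_def)
    then have sub: "{c..d} \<subseteq> I"
      using \<open>is_interval I\<close> by (meson atLeastAtMost_iff is_interval_1 subsetI)
    have "compact (A ` {c..d})"
      by (intro compact_continuous_image continuous_on_subset[OF contA sub]) auto
    then obtain M where M: "M > 0" "\<And>s. s \<in> {c..d} \<Longrightarrow> norm (A s) \<le> M"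
      using compact_imp_bounded bounded_pos by (metis imageI)
    have AM: "norm (A s v) \<le> M * norm v" if "s \<in> {c..d}" for s v
      by (meson M(2)[OF that] mult_right_mono norm_blinfun norm_ge_zero order_trans)
    have bndY: "s \<in> {c..d} \<Longrightarrow> norm (Y n s) \<le> norm y0 * M ^ n / fact n * \<bar>s - t0\<bar> ^ n" for n s
    proof (induction n arbitrary: s)
      case (Suc n)
      have seg: "closed_segment t0 s \<subseteq> {c..d}"
        using Suc.prems cd by (auto simp: closed_segment_eq_real_ivl split: if_splits)
      have "norm (Y (Suc n) s) \<le> (M * (norm y0 * M ^ n / fact n)) * \<bar>s - t0\<bar> ^ Suc n / Suc n"
      proof (rule norm_antiderivative_power_bound[OF derY])
        fix r assume r: "r \<in> closed_segment t0 s"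
        with seg sub show "r \<in> I" by auto
        have "norm (A r (Y n r)) \<le> M * norm (Y n r)" using AM r seg by auto
        also have "\<dots> \<le> M * (norm y0 * M ^ n / fact n * \<bar>r - t0\<bar> ^ n)"
          using Suc.IH r seg M(1) by (intro mult_left_mono) auto
        finally show "norm (A r (Y n r)) \<le> M * (norm y0 * M ^ n / fact n) * \<bar>r - t0\<bar> ^ n"
          by (simp add: mult_ac)
      qed (rule YS0)
      then show ?case by (simp add: field_simps)
    qed (simp add: Y0)
    define L where "L = M * (d - c)"
    have bndY': "norm (Y n s) \<le> norm y0 * (L ^ n /\<^sub>R fact n)" if "s \<in> {c..d}" for n s
    proof -
      have "\<bar>s - t0\<bar> ^ n \<le> (d - c) ^ n"
        using that cd by (intro power_mono) auto
      then have "norm y0 * M ^ n / fact n * \<bar>s - t0\<bar> ^ n \<le> norm y0 * M ^ n / fact n * (d - c) ^ n"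
        using M(1) by (intro mult_left_mono) auto
      also have "\<dots> = norm y0 * (L ^ n /\<^sub>R fact n)"
        by (simp add: L_def power_mult_distrib divide_inverse mult_ac)
      finally show ?thesis using bndY[OF that, of n] by linarith
    qed
    have summ: "summable (\<lambda>n. norm y0 * (L ^ n /\<^sub>R fact n))"
      by (rule summable_mult[OF summable_exp_generic])
    have unif: "uniform_limit {c..d} (\<lambda>n s. \<Sum>i<n. Y i s) y sequentially"
      unfolding y_def by (rule Weierstrass_m_test[OF bndY' summ])
    have sums: "(\<lambda>n. Y n s) sums y s" if "s \<in> {c..d}" for s
      unfolding y_def
      by (rule summable_sums, rule summable_comparison_test'[OF summ bndY'[OF that]])
    \<comment> \<open>the derivative of \<open>Y n\<close>; its partial sums lag one step behind,
      \<open>(\<Sum>i<m+1. f' i s h) = h *\<^sub>R A s (\<Sum>i<m. Y i s)\<close>\<close>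
    define f' where "f' n s h = h *\<^sub>R (case n of 0 \<Rightarrow> 0 | Suc m \<Rightarrow> A s (Y m s))"
      for n s and h :: real
    have "\<exists>g. \<forall>s\<in>{c<..<d}. (\<lambda>n. Y n s) sums g s \<and>
        (g has_derivative (\<lambda>h. h *\<^sub>R A s (y s))) (at s within {c<..<d})"
    proof (rule has_derivative_series[where f' = f' and x = t])
      fix n s assume s: "s \<in> {c<..<d}"
      have "f' 0 s = (\<lambda>_. 0)" "f' (Suc m) s = (\<lambda>h. h *\<^sub>R A s (Y m s))" for m
        by (auto simp: f'_def)
      with s have "(Y n has_derivative f' n s) (at s)"
        using derY[of s "n - 1"] sub
        by (cases n) (auto simp: Y0 has_vector_derivative_def subset_eq)
      then show "(Y n has_derivative f' n s) (at s within {c<..<d})"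
        by (rule has_derivative_at_withinI)
    next
      fix \<epsilon> :: real assume "\<epsilon> > 0"
      with M(1) unif have "\<forall>\<^sub>F n in sequentially. \<forall>s\<in>{c..d}. dist (\<Sum>i<n. Y i s) (y s) < \<epsilon> / M"
        unfolding uniform_limit_iff by auto
      then obtain N where N: "\<And>n s. n \<ge> N \<Longrightarrow> s \<in> {c..d} \<Longrightarrow> norm ((\<Sum>i<n. Y i s) - y s) < \<epsilon> / M"
        unfolding eventually_sequentially dist_norm by blast
      have "norm ((\<Sum>i<n. f' i s h) - h *\<^sub>R A s (y s)) \<le> \<epsilon> * norm h"
        if n: "n \<ge> Suc N" and s: "s \<in> {c<..<d}" for n s h
      proof -
        obtain m where m: "n = Suc m" "m \<ge> N" using n by (cases n) auto
        have "(\<Sum>i<n. f' i s h) = h *\<^sub>R A s (\<Sum>i<m. Y i s)"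
          unfolding m(1) sum.lessThan_Suc_shift by (simp add: f'_def scaleR_sum_right blinfun.sum_right)
        then have "norm ((\<Sum>i<n. f' i s h) - h *\<^sub>R A s (y s)) =
            \<bar>h\<bar> * norm (A s ((\<Sum>i<m. Y i s) - y s))"
          by (simp add: blinfun.diff_right scaleR_diff_right[symmetric])
        also have "\<dots> \<le> \<bar>h\<bar> * (M * norm ((\<Sum>i<m. Y i s) - y s))"
          using AM s by (intro mult_left_mono) auto
        also have "\<dots> \<le> \<bar>h\<bar> * \<epsilon>"
          using N[OF m(2), of s] s M(1) by (intro mult_left_mono) (auto simp: field_simps)
        finally show ?thesis by (simp add: mult.commute)
      qed
      then show "\<forall>\<^sub>F n in sequentially. \<forall>s\<in>{c<..<d}. \<forall>h.
          norm ((\<Sum>i<n. f' i s h) - h *\<^sub>R A s (y s)) \<le> \<epsilon> * norm h"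
        unfolding eventually_sequentially by blast
    qed (use cd sums in \<open>auto intro!: sums\<close>)
    then obtain g where g: "\<And>s. s \<in> {c<..<d} \<Longrightarrow> (\<lambda>n. Y n s) sums g s"
      "\<And>s. s \<in> {c<..<d} \<Longrightarrow> (g has_vector_derivative A s (y s)) (at s within {c<..<d})"
      unfolding has_vector_derivative_def by blast
    have "g s = y s" if "s \<in> {c<..<d}" for s
      using sums[of s] g(1)[OF that] that sums_unique2 by auto
    moreover have "(g has_vector_derivative A t (y t)) (at t)"
      using g(2)[OF cd(1)] cd(1) has_vector_derivative_within_open open_greaterThanLessThan by blast
    ultimately have "(y has_vector_derivative A t (y t)) (at t)"
      using cd(1) has_vector_derivative_transform_within_open open_greaterThanLessThan by blast
    then show ?thesis using sums cd(1) by auto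
  qed
  have "(\<lambda>n. Y n t0) sums Y 0 t0"
  proof -
    have "Y n t0 = 0" if "n \<notin> {0}" for n
      using that YS0 by (cases n) auto
    then show ?thesis using sums_finite[of "{0}" "\<lambda>n. Y n t0"] by simp
  qed
  then have "y t0 = y0" using main[OF assms(3)] sums_unique2 Y0 by fastforce
  with main show ?thesis using that by blast
qed

section \<open>The Lorentz product and orthonormal frames\<close>

lemma bounded_bilinear_lorentz: "bounded_bilinear lorentz"
  unfolding bilinear_conv_bounded_bilinear[symmetric] bilinear_def
  by (auto intro!: linearI simp: lorentz_def algebra_simps)

lemmas lorentz_simps =
  bounded_bilinear.add_left[OF bounded_bilinear_lorentz]
  bounded_bilinear.add_right[OF bounded_bilinear_lorentz]
  bounded_bilinear.minus_left[OF bounded_bilinear_lorentz]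
  bounded_bilinear.minus_right[OF bounded_bilinear_lorentz]
  bounded_bilinear.diff_left[OF bounded_bilinear_lorentz]
  bounded_bilinear.diff_right[OF bounded_bilinear_lorentz]
  bounded_bilinear.zero_left[OF bounded_bilinear_lorentz]
  bounded_bilinear.zero_right[OF bounded_bilinear_lorentz]
  bounded_bilinear.scaleR_left[OF bounded_bilinear_lorentz]
  bounded_bilinear.scaleR_right[OF bounded_bilinear_lorentz]

lemmas smooth_on_lorentz = smooth_on_bounded_bilinear[OF bounded_bilinear_lorentz]
lemmas has_vector_derivative_lorentz =
  bounded_bilinear.has_vector_derivative[OF bounded_bilinear_lorentz]

lemma lorentz_commute: "lorentz x y = lorentz y x"
  by (simp add: lorentz_def mult.commute)

definition lorentz_orthonormal :: "real^4^4 \<Rightarrow> bool" where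
  "lorentz_orthonormal z \<longleftrightarrow>
     (\<forall>i j. lorentz (z $ i) (z $ j) = (if i = j then if i = 1 then -1 else 1 else 0))"

text \<open>Orthonormality says \<open>Z \<eta> Z\<^sup>T \<eta> = 1\<close> for the matrix \<open>\<eta>\<close> of the Lorentz product, i.e. that
\<open>W = \<eta> Z\<^sup>T \<eta>\<close> is a right inverse of \<open>Z\<close>. A right inverse of a square matrix is also a left
inverse, and \<open>v = v W Z\<close> is the expansion.\<close>
lemma lorentz_orthonormal_expansion:
  assumes "lorentz_orthonormal z"
  shows "v = - lorentz v (z $ 1) *\<^sub>R z $ 1 + lorentz v (z $ 2) *\<^sub>R z $ 2
    + lorentz v (z $ 3) *\<^sub>R z $ 3 + lorentz v (z $ 4) *\<^sub>R z $ 4"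
proof -
  define \<epsilon> :: "4 \<Rightarrow> real" where "\<epsilon> i = (if i = 1 then -1 else 1)" for i
  have lor: "lorentz x y = (\<Sum>l\<in>UNIV. x $ l * \<epsilon> l * y $ l)" for x y
    by (simp add: lorentz_def \<epsilon>_def sum_4)
  define w :: "real^4^4" where "w = (\<chi> l j. \<epsilon> l * z $ j $ l * \<epsilon> j)"
  have "(\<Sum>l\<in>UNIV. z $ i $ l * (\<epsilon> l * z $ j $ l * \<epsilon> j)) = lorentz (z $ i) (z $ j) * \<epsilon> j" for i j
    unfolding lor sum_distrib_right by (simp add: mult_ac)
  then have "z ** w = mat 1"
    using assms by (simp add: matrix_matrix_mult_def mat_def w_def lorentz_orthonormal_def vec_eq_iff \<epsilon>_def)
  then have "v = v v* (w ** z)"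
    unfolding matrix_left_right_inverse by simp
  also have "\<dots> = (v v* w) v* z"
    by (simp add: vector_matrix_mul_assoc)
  also have "\<dots> = (\<Sum>j\<in>UNIV. (\<epsilon> j * lorentz v (z $ j)) *\<^sub>R z $ j)"
    unfolding lor
    by (simp add: vector_matrix_mult_def vec_eq_iff w_def sum_distrib_left sum_distrib_right mult_ac)
  finally show ?thesis by (simp add: sum_4 \<epsilon>_def)
qed

lemma orthonormal_frame_iff:
  assumes "proper_time I \<gamma>"
  shows "orthonormal_frame I \<gamma> Z \<longleftrightarrow>
    smooth_on I Z \<and> (\<forall>t\<in>I. Z t $ 1 = tangent \<gamma> t \<and> lorentz_orthonormal (Z t))"
proof -
  have "(\<forall>i\<in>{2,3,4}. lorentz (tangent \<gamma> t) (Z t $ i) = 0) \<and>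
      (\<forall>i\<in>{2,3,4}. \<forall>j\<in>{2,3,4}. lorentz (Z t $ i) (Z t $ j) = (if i = j then 1 else 0))
    \<longleftrightarrow> lorentz_orthonormal (Z t)" if "t \<in> I" "Z t $ 1 = tangent \<gamma> t" for t
    using assms that
    by (auto simp: lorentz_orthonormal_def forall_4 proper_time_def lorentz_commute)
  then show ?thesis unfolding orthonormal_frame_def by blast
qed

text \<open>For \<open>j \<noteq> 1\<close> this is the entry \<open>(i, j)\<close> of the coefficient matrix; for \<open>j = 1\<close> it is minus the
entry, as the first frame vector has square \<open>-1\<close>.\<close>
definition connection_coeff :: "(real \<Rightarrow> real^4^4) \<Rightarrow> 4 \<Rightarrow> 4 \<Rightarrow> real \<Rightarrow> real" where
  "connection_coeff Z i j t = lorentz (vector_derivative Z (at t) $ i) (Z t $ j)"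

lemma smooth_on_connection_coeff:
  assumes "open I" "smooth_on I Z"
  shows "smooth_on I (connection_coeff Z i j)"
  unfolding connection_coeff_def[abs_def]
  by (intro smooth_on_lorentz smooth_on_vec_nth smooth_on_vector_derivative assms)

lemma has_vector_derivative_vec_nth:
  "(Z has_vector_derivative D) F \<Longrightarrow> ((\<lambda>t. Z t $ i) has_vector_derivative D $ i) F"
  by (rule bounded_linear.has_vector_derivative[OF bounded_linear_vec_nth])

text \<open>Differentiation of the constant function \<open>lorentz (Z s $ i) (Z s $ j)\<close>.\<close>
lemma connection_coeff_antisym:
  assumes "open I" "smooth_on I Z" "t \<in> I" "\<And>s. s \<in> I \<Longrightarrow> lorentz_orthonormal (Z s)"
  shows "connection_coeff Z i j t = - connection_coeff Z j i t"
proof -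
  note D = has_vector_derivative_vec_nth[OF smooth_on_has_vector_derivative[OF assms(1-3)]]
  have "((\<lambda>s. lorentz (Z s $ i) (Z s $ j)) has_vector_derivative
      connection_coeff Z j i t + connection_coeff Z i j t) (at t)"
    using has_vector_derivative_lorentz[OF D D, of i j]
    by (simp add: connection_coeff_def lorentz_commute)
  moreover have "((\<lambda>s. lorentz (Z s $ i) (Z s $ j)) has_vector_derivative 0) (at t)"
  proof (subst has_vector_derivative_cong_open[OF assms(1,3)])
    show "lorentz (Z s $ i) (Z s $ j) = (if i = j then if i = 1 then -1 else 1 else 0)"
      if "s \<in> I" for s
      using assms(4)[OF that] unfolding lorentz_orthonormal_def by blast
  qed simp
  ultimately have "connection_coeff Z j i t + connection_coeff Z i j t = 0"
    by (rule vector_derivative_unique_at)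
  then show ?thesis by simp
qed

text \<open>Every orthonormal frame has a coefficient matrix, with only six free entries. Hence the type of a
frame is decided by which of these six functions vanish identically.\<close>
lemma frame_equations:
  assumes "open I" "proper_time I \<gamma>" "orthonormal_frame I \<gamma> Z" "t \<in> I"
  defines "\<omega> \<equiv> \<lambda>i j. connection_coeff Z i j t"
  shows "(Z has_vector_derivative
    vector [vector [0, \<omega> 1 2, \<omega> 1 3, \<omega> 1 4],
            vector [\<omega> 1 2, 0, \<omega> 2 3, \<omega> 2 4],
            vector [\<omega> 1 3, - \<omega> 2 3, 0, \<omega> 3 4],
            vector [\<omega> 1 4, - \<omega> 2 4, - \<omega> 3 4, 0]] ** Z t) (at t)"
proof -
  from assms have Z: "smooth_on I Z" "\<And>s. s \<in> I \<Longrightarrow> lorentz_orthonormal (Z s)"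
    by (auto simp: orthonormal_frame_iff)
  let ?D = "vector_derivative Z (at t)"
  have anti: "\<omega> i j = - \<omega> j i" for i j
    unfolding \<omega>_def by (rule connection_coeff_antisym[OF assms(1) Z(1) assms(4) Z(2)])
  have row: "?D $ i = - \<omega> i 1 *\<^sub>R Z t $ 1 + \<omega> i 2 *\<^sub>R Z t $ 2 + \<omega> i 3 *\<^sub>R Z t $ 3 + \<omega> i 4 *\<^sub>R Z t $ 4" for i
    using lorentz_orthonormal_expansion[OF Z(2)[OF assms(4)]] by (simp add: \<omega>_def connection_coeff_def)
  have diag: "\<omega> i i = 0" for i using anti[of i i] by simp
  have "?D = vector [vector [0, \<omega> 1 2, \<omega> 1 3, \<omega> 1 4],
            vector [\<omega> 1 2, 0, \<omega> 2 3, \<omega> 2 4],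
            vector [\<omega> 1 3, - \<omega> 2 3, 0, \<omega> 3 4],
            vector [\<omega> 1 4, - \<omega> 2 4, - \<omega> 3 4, 0]] ** Z t" (is "_ = ?X ** _")
  proof -
    note a = anti[of 2 1] anti[of 3 1] anti[of 4 1] anti[of 3 2] anti[of 4 2] anti[of 4 3]
    have "\<forall>i. ?D $ i = (\<chi> l. \<Sum>k\<in>UNIV. ?X $ i $ k * Z t $ k $ l)"
      unfolding forall_4 row a diag by (simp add: sum_4 vector_4 vec_eq_iff)
    then show ?thesis by (simp add: matrix_matrix_mult_def vec_eq_iff)
  qed
  with smooth_on_has_vector_derivative[OF assms(1) Z(1) assms(4)] show ?thesis by simp
qed

text \<open>The forms B, C and D each demand that three of the six coefficients vanish, and leave the other
three arbitrary.\<close>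
lemma bishop_frameI:
  assumes "open I" "proper_time I \<gamma>" "orthonormal_frame I \<gamma> Z"
  shows "(\<And>t. t \<in> I \<Longrightarrow> connection_coeff Z 2 3 t = 0 \<and> connection_coeff Z 2 4 t = 0
      \<and> connection_coeff Z 3 4 t = 0) \<Longrightarrow> bishop_frame form_B I \<gamma> Z"
    and "(\<And>t. t \<in> I \<Longrightarrow> connection_coeff Z 1 4 t = 0 \<and> connection_coeff Z 2 3 t = 0
      \<and> connection_coeff Z 3 4 t = 0) \<Longrightarrow> bishop_frame form_C I \<gamma> Z"
    and "(\<And>t. t \<in> I \<Longrightarrow> connection_coeff Z 1 3 t = 0 \<and> connection_coeff Z 1 4 t = 0
      \<and> connection_coeff Z 3 4 t = 0) \<Longrightarrow> bishop_frame form_D I \<gamma> Z"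
proof -
  let ?\<omega> = "connection_coeff Z"
  have bishop: "bishop_frame form I \<gamma> Z"
    if "\<And>t. t \<in> I \<Longrightarrow> (Z has_vector_derivative form (?\<omega> i j t) (?\<omega> k l t) (?\<omega> m n t) ** Z t) (at t)"
    for form i j k l m n
  proof -
    have "smooth_on I (?\<omega> a b)" for a b
      using assms by (intro smooth_on_connection_coeff) (auto simp: orthonormal_frame_def)
    moreover have "coefficient_matrix I (\<lambda>t. \<chi> a. Z t $ id a)
        (\<lambda>t. form (?\<omega> i j t) (?\<omega> k l t) (?\<omega> m n t))"
      using that by (simp add: coefficient_matrix_def)
    ultimately show ?thesis
      unfolding bishop_frame_def
      using assms(3) permutes_id[of "{2, 3, 4 :: 4}"] by blast
  qed
  note eqs = frame_equations[OF assms]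
  show "bishop_frame form_B I \<gamma> Z" if "\<And>t. t \<in> I \<Longrightarrow> ?\<omega> 2 3 t = 0 \<and> ?\<omega> 2 4 t = 0 \<and> ?\<omega> 3 4 t = 0"
    using eqs that by (intro bishop[of _ 1 2 1 3 1 4]) (auto simp: form_B_def)
  show "bishop_frame form_C I \<gamma> Z" if "\<And>t. t \<in> I \<Longrightarrow> ?\<omega> 1 4 t = 0 \<and> ?\<omega> 2 3 t = 0 \<and> ?\<omega> 3 4 t = 0"
    using eqs that by (intro bishop[of _ 1 2 1 3 2 4]) (auto simp: form_C_def)
  show "bishop_frame form_D I \<gamma> Z" if "\<And>t. t \<in> I \<Longrightarrow> ?\<omega> 1 3 t = 0 \<and> ?\<omega> 1 4 t = 0 \<and> ?\<omega> 3 4 t = 0"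
    using eqs that by (intro bishop[of _ 1 2 2 3 2 4]) (auto simp: form_D_def)
qed

section \<open>Rotation of the space-like part of a frame\<close>

text \<open>For an orthonormal frame an isometry of Euclidean three-space onto the orthogonal complement of
the tangent vector; it makes the cross product available there.\<close>
definition spatial :: "real^4^4 \<Rightarrow> real^3 \<Rightarrow> real^4" where
  "spatial z w = w $ 1 *\<^sub>R z $ 2 + w $ 2 *\<^sub>R z $ 3 + w $ 3 *\<^sub>R z $ 4"

definition rotate_frame :: "real^4^4 \<Rightarrow> real^3^3 \<Rightarrow> real^4^4" where
  "rotate_frame z r = vector [z $ 1, spatial z (r $ 1), spatial z (r $ 2), spatial z (r $ 3)]"

lemma rotate_frame_nth [simp]:
  "rotate_frame z r $ 1 = z $ 1" "rotate_frame z r $ 2 = spatial z (r $ 1)"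
  "rotate_frame z r $ 3 = spatial z (r $ 2)" "rotate_frame z r $ 4 = spatial z (r $ 3)"
  by (simp_all add: rotate_frame_def vector_4)

lemma lorentz_spatial:
  assumes "lorentz_orthonormal z"
  shows "lorentz (spatial z v) (spatial z w) = v \<bullet> w"
    and "lorentz (z $ 1) (spatial z w) = 0" "lorentz (spatial z w) (z $ 1) = 0"
  using assms
  by (simp_all add: lorentz_orthonormal_def spatial_def lorentz_simps inner_vec_def sum_3)

lemma bounded_bilinear_spatial: "bounded_bilinear spatial"
  unfolding bilinear_conv_bounded_bilinear[symmetric] bilinear_def
  by (auto intro!: linearI simp: spatial_def algebra_simps)

lemma orthonormal_frame_rotate:
  assumes "open I" "proper_time I \<gamma>" "orthonormal_frame I \<gamma> P" "smooth_on I R"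
    and R: "\<And>t i j. t \<in> I \<Longrightarrow> R t $ i \<bullet> R t $ j = (if i = j then 1 else 0)"
  shows "orthonormal_frame I \<gamma> (\<lambda>t. rotate_frame (P t) (R t))"
proof -
  have P: "smooth_on I P" "\<And>t. t \<in> I \<Longrightarrow> P t $ 1 = tangent \<gamma> t \<and> lorentz_orthonormal (P t)"
    using assms(2,3) orthonormal_frame_iff by auto
  have "smooth_on I (\<lambda>t. rotate_frame (P t) (R t) $ i)" for i
  proof -
    have "smooth_on I (\<lambda>t. spatial (P t) (R t $ j))" for j
      by (intro smooth_on_bounded_bilinear[OF bounded_bilinear_spatial] smooth_on_vec_nth P assms)
    moreover have "smooth_on I (\<lambda>t. P t $ 1)" by (intro smooth_on_vec_nth P assms)
    ultimately show ?thesis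
      using exhaust_4[of i] by auto
  qed
  then have "smooth_on I (\<lambda>t. rotate_frame (P t) (R t))"
    by (rule smooth_on_vec[OF assms(1)])
  moreover have "lorentz_orthonormal (rotate_frame (P t) (R t))" if "t \<in> I" for t
  proof -
    note P(2)[OF that, THEN conjunct2]
    from lorentz_spatial[OF this] this R[OF that] show ?thesis
      unfolding lorentz_orthonormal_def forall_4 rotate_frame_nth
      by auto
  qed
  ultimately show ?thesis
    using P(2) by (auto simp: orthonormal_frame_iff[OF assms(2)])
qed

lemma tangent_derivative_spatial:
  assumes "open I" "proper_time I \<gamma>" "orthonormal_frame I \<gamma> P" "t \<in> I"
  shows "vector_derivative P (at t) $ 1 = spatial (P t)
    (vector [connection_coeff P 1 2 t, connection_coeff P 1 3 t, connection_coeff P 1 4 t])"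
  unfolding vector_derivative_at[OF frame_equations[OF assms]]
  by (simp add: vec_eq_iff matrix_matrix_mult_def sum_4 vector_4 spatial_def)

text \<open>The tangent vector is common to both frames, so the first row of the coefficient matrix is just the
coordinate vector of \<open>T'\<close>, read off in the rotated basis.\<close>
lemma connection_coeff_rotate_tangent:
  assumes "open I" "proper_time I \<gamma>" "orthonormal_frame I \<gamma> P" "t \<in> I"
    and Z: "smooth_on I (\<lambda>t. rotate_frame (P t) (R t))" (is "smooth_on I ?Z")
    and j: "\<And>z r. rotate_frame z r $ j = spatial z (r $ l)"
  shows "connection_coeff (\<lambda>t. rotate_frame (P t) (R t)) 1 j t =
    vector [connection_coeff P 1 2 t, connection_coeff P 1 3 t, connection_coeff P 1 4 t] \<bullet> R t $ l"
proof -
  have P: "smooth_on I P" "lorentz_orthonormal (P t)"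
    using assms(2-4) orthonormal_frame_iff by auto
  note D = smooth_on_has_vector_derivative[OF assms(1) _ assms(4)]
  have "((\<lambda>s. P s $ 1) has_vector_derivative vector_derivative ?Z (at t) $ 1) (at t)"
    using has_vector_derivative_vec_nth[OF D[OF Z], of 1] unfolding rotate_frame_nth .
  from vector_derivative_unique_at[OF this has_vector_derivative_vec_nth[OF D[OF P(1)]]]
  have "vector_derivative ?Z (at t) $ 1 = vector_derivative P (at t) $ 1" .
  then show ?thesis
    unfolding connection_coeff_def[of ?Z] tangent_derivative_spatial[OF assms(1-4)] j
    by (simp only: tangent_derivative_spatial[OF assms(1-4)] lorentz_spatial[OF P(2)])
qed

text \<open>Leibniz rule for \<open>spatial (P t) (R t $ k)\<close>: one term comes from the motion of the coordinates, the
other from the motion of the frame.\<close>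
lemma connection_coeff_rotate_spatial:
  assumes "open I" "proper_time I \<gamma>" "orthonormal_frame I \<gamma> P" "t \<in> I"
    and Z: "smooth_on I (\<lambda>t. rotate_frame (P t) (R t))" (is "smooth_on I ?Z")
    and i: "\<And>z r. rotate_frame z r $ i = spatial z (r $ k)"
    and j: "\<And>z r. rotate_frame z r $ j = spatial z (r $ l)"
    and r: "((\<lambda>t. R t $ k) has_vector_derivative r) (at t)"
  shows "connection_coeff (\<lambda>t. rotate_frame (P t) (R t)) i j t =
    r \<bullet> R t $ l + lorentz (spatial (vector_derivative P (at t)) (R t $ k)) (spatial (P t) (R t $ l))"
proof -
  have P: "smooth_on I P" "lorentz_orthonormal (P t)"
    using assms(2-4) orthonormal_frame_iff by auto
  note D = smooth_on_has_vector_derivative[OF assms(1) _ assms(4)]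
  have "((\<lambda>t. ?Z t $ i) has_vector_derivative
      spatial (P t) r + spatial (vector_derivative P (at t)) (R t $ k)) (at t)"
    unfolding i
    by (rule bounded_bilinear.has_vector_derivative[OF bounded_bilinear_spatial D[OF P(1)] r])
  from vector_derivative_unique_at[OF has_vector_derivative_vec_nth[OF D[OF Z], of i] this]
  have "vector_derivative ?Z (at t) $ i = spatial (P t) r + spatial (vector_derivative P (at t)) (R t $ k)" .
  then show ?thesis
    unfolding connection_coeff_def j by (simp add: lorentz_simps lorentz_spatial[OF P(2)])
qed

section \<open>From type F to type D\<close>

text \<open>The permutation allowed in the definition is absorbed into the frame itself.\<close>
lemma admits_type_F_in_displayed_order:
  assumes "open I" "proper_time I \<gamma>" "admits_bishop_frame form_F I \<gamma>"
  obtains E x1 x2 x3 where "orthonormal_frame I \<gamma> E"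
    "smooth_on I x1" "smooth_on I x2" "smooth_on I x3"
    "coefficient_matrix I E (\<lambda>t. form_F (x1 t) (x2 t) (x3 t))"
proof -
  from assms(3) obtain Z p x1 x2 x3 where Z: "orthonormal_frame I \<gamma> Z" and p: "p permutes {2, 3, 4}"
    and x: "smooth_on I x1" "smooth_on I x2" "smooth_on I x3"
    "coefficient_matrix I (\<lambda>t. \<chi> i. Z t $ p i) (\<lambda>t. form_F (x1 t) (x2 t) (x3 t))"
    unfolding admits_bishop_frame_def bishop_frame_def by blast
  have p1: "p 1 = 1" using permutes_not_in[OF p, of 1] by simp
  have inj: "p i = p j \<longleftrightarrow> i = j" for i j using permutes_inj[OF p] by (auto dest: injD)
  then have "p i = 1 \<longleftrightarrow> i = 1" for i using p1 by metis
  moreover have "smooth_on I Z"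
    using Z by (simp add: orthonormal_frame_def)
  then have "smooth_on I (\<lambda>t. \<chi> i. Z t $ p i)"
    by (intro smooth_on_vec[OF assms(1)]) (simp add: smooth_on_vec_nth[OF assms(1)])
  ultimately have "orthonormal_frame I \<gamma> (\<lambda>t. \<chi> i. Z t $ p i)"
    using Z inj
    by (simp add: orthonormal_frame_iff[OF assms(2)] lorentz_orthonormal_def p1)
  with x show ?thesis using that by blast
qed

lemma connection_coeff_form_F:
  assumes "orthonormal_frame I \<gamma> E" "proper_time I \<gamma>" "t \<in> I"
    "coefficient_matrix I E (\<lambda>t. form_F (x1 t) (x2 t) (x3 t))"
  shows "connection_coeff E 1 3 t = 0" "connection_coeff E 1 4 t = 0"
    "connection_coeff E 3 4 t = x3 t" "connection_coeff E 4 3 t = - x3 t"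
    "connection_coeff E 3 3 t = 0" "connection_coeff E 4 4 t = 0"
proof -
  have "vector_derivative E (at t) = form_F (x1 t) (x2 t) (x3 t) ** E t"
    using assms(3,4) by (auto simp: coefficient_matrix_def intro: vector_derivative_at)
  then have "connection_coeff E i j t = (\<Sum>k\<in>UNIV. form_F (x1 t) (x2 t) (x3 t) $ i $ k * lorentz (E t $ k) (E t $ j))"
    for i j
    by (simp add: connection_coeff_def lorentz_def matrix_matrix_mult_def sum_4 algebra_simps)
  moreover have "lorentz_orthonormal (E t)"
    using assms(1-3) by (auto simp: orthonormal_frame_iff)
  ultimately show "connection_coeff E 1 3 t = 0" "connection_coeff E 1 4 t = 0"
    "connection_coeff E 3 4 t = x3 t" "connection_coeff E 4 3 t = - x3 t"
    "connection_coeff E 3 3 t = 0" "connection_coeff E 4 4 t = 0"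
    by (simp_all add: lorentz_orthonormal_def form_F_def sum_4 vector_4)
qed

text \<open>In a type F frame \<open>T'\<close> is already a multiple of the second vector, so this vector is kept and only
the last coefficient, \<open>x3\<close>, has to be removed. A rotation by \<open>\<theta>\<close> in the plane of the last two
vectors changes it into \<open>x3 + \<theta>'\<close>, whence the choice of \<open>\<theta>\<close> as a primitive of \<open>- x3\<close>.\<close>
lemma admits_type_D:
  assumes "open I" "is_interval I" "proper_time I \<gamma>" "t0 \<in> I"
    and E: "orthonormal_frame I \<gamma> E" "smooth_on I x3"
    "coefficient_matrix I E (\<lambda>t. form_F (x1 t) (x2 t) (x3 t))"
  shows "admits_bishop_frame form_D I \<gamma>"
proof -
  have x3: "smooth_on I (\<lambda>t. - x3 t)" by (intro smooth_on_minus assms)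
  obtain \<theta> where \<theta>: "\<And>t. t \<in> I \<Longrightarrow> (\<theta> has_vector_derivative - x3 t) (at t)"
    using antiderivative_on_open_interval[OF assms(1,2) smooth_on_continuous_on[OF assms(1) x3] assms(4), of 0]
    by blast
  then have "smooth_on I \<theta>"
    using smooth_on_derivative_iff[OF assms(1) \<theta>] x3 by blast
  note cs = smooth_on_cos_sin[OF assms(1) this]
  define R :: "real \<Rightarrow> real^3^3" where "R t = vector [vector [1, 0, 0],
    vector [0, cos (\<theta> t), sin (\<theta> t)], vector [0, - sin (\<theta> t), cos (\<theta> t)]]" for t
  have "smooth_on I R"
  proof (intro smooth_on_vec[OF assms(1)])
    show "smooth_on I (\<lambda>t. R t $ i $ j)" for i j
      using exhaust_3[of i] exhaust_3[of j] cs smooth_on_minus[OF assms(1) cs(2)] smooth_on_const[OF assms(1)]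
      by (auto simp: R_def)
  qed
  moreover have R_orth: "R t $ i \<bullet> R t $ j = (if i = j then 1 else 0)" for t i j
    using exhaust_3[of i] exhaust_3[of j]
    by (auto simp: R_def inner_vec_def sum_3 power2_eq_square[symmetric])
  ultimately have Z: "orthonormal_frame I \<gamma> (\<lambda>t. rotate_frame (E t) (R t))"
    by (intro orthonormal_frame_rotate assms)
  then have smZ: "smooth_on I (\<lambda>t. rotate_frame (E t) (R t))"
    unfolding orthonormal_frame_def by simp
  let ?Z = "\<lambda>t. rotate_frame (E t) (R t)"
  have "connection_coeff ?Z 1 3 t = 0 \<and> connection_coeff ?Z 1 4 t = 0 \<and> connection_coeff ?Z 3 4 t = 0"
    if t: "t \<in> I" for t
  proof -
    note \<omega> = connection_coeff_form_F[OF E(1) assms(3) t E(3)]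
    have \<theta>': "(\<theta> has_field_derivative - x3 t) (at t)"
      using \<theta>[OF t] by (simp add: has_real_derivative_iff_has_vector_derivative)
    have "((\<lambda>t. R t $ 2) has_vector_derivative (- x3 t) *\<^sub>R R t $ 3) (at t)"
    proof (rule has_vector_derivative_vec)
      show "((\<lambda>t. R t $ 2 $ j) has_vector_derivative ((- x3 t) *\<^sub>R R t $ 3) $ j) (at t)" for j
        using exhaust_3[of j]
        by (auto simp: R_def simp flip: has_real_derivative_iff_has_vector_derivative
            intro!: derivative_eq_intros \<theta>')
    qed
    from connection_coeff_rotate_spatial[OF assms(1,3) E(1) t smZ rotate_frame_nth(3,4) this]
    have "connection_coeff ?Z 3 4 t = - x3 t * (R t $ 3 \<bullet> R t $ 3) +
        lorentz (spatial (vector_derivative E (at t)) (R t $ 2)) (spatial (E t) (R t $ 3))"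
      by simp
    also have "R t $ 3 \<bullet> R t $ 3 = 1" by (simp add: R_orth)
    also have "lorentz (spatial (vector_derivative E (at t)) (R t $ 2)) (spatial (E t) (R t $ 3)) =
        (cos (\<theta> t) * cos (\<theta> t) + sin (\<theta> t) * sin (\<theta> t)) * x3 t"
      using \<omega>(3-6)
      by (simp add: spatial_def R_def lorentz_simps connection_coeff_def algebra_simps
          del: sin_cos_squared_add3)
    finally have "connection_coeff ?Z 3 4 t = 0" by simp
    moreover have "connection_coeff ?Z 1 3 t = 0"
      by (subst connection_coeff_rotate_tangent[OF assms(1,3) E(1) t smZ rotate_frame_nth(3)])
        (simp_all add: \<omega> R_def inner_vec_def sum_3)
    moreover have "connection_coeff ?Z 1 4 t = 0"
      by (subst connection_coeff_rotate_tangent[OF assms(1,3) E(1) t smZ rotate_frame_nth(4)])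
        (simp_all add: \<omega> R_def inner_vec_def sum_3)
    ultimately show ?thesis by simp
  qed
  from bishop_frameI(3)[OF assms(1,3) Z this] show ?thesis
    unfolding admits_bishop_frame_def by blast
qed

section \<open>Fermi-Walker transport and type B\<close>

text \<open>The right-hand side of the Fermi-Walker equation \<open>w' = \<langle>w, a\<rangle> u - \<langle>w, u\<rangle> a\<close> along a world line
with velocity \<open>u\<close> and acceleration \<open>a\<close>. As a map of \<open>w\<close> it is skew with respect to the Lorentz
product.\<close>
definition fermi_walker :: "real^4 \<Rightarrow> real^4 \<Rightarrow> real^4 \<Rightarrow> real^4" where
  "fermi_walker u a w = lorentz w a *\<^sub>R u - lorentz w u *\<^sub>R a"

lemma bounded_linear_fermi_walker: "bounded_linear (fermi_walker u a)"
  unfolding fermi_walker_def[abs_def] linear_conv_bounded_linear[symmetric]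
  by (auto intro!: linearI simp: lorentz_simps algebra_simps)

lemma fermi_walker_transport:
  assumes "open I" "is_interval I" "t0 \<in> I" "smooth_on I u" "smooth_on I a"
  obtains w where "w t0 = w0" "smooth_on I w"
    "\<And>t. t \<in> I \<Longrightarrow> (w has_vector_derivative fermi_walker (u t) (a t) (w t)) (at t)"
proof -
  define A where "A t = Blinfun (fermi_walker (u t) (a t))" for t
  have A: "blinfun_apply (A t) = fermi_walker (u t) (a t)" for t
    unfolding A_def by (rule bounded_linear_Blinfun_apply[OF bounded_linear_fermi_walker])
  have "continuous_on I A"
  proof (rule continuous_on_blinfun_componentwise)
    fix b :: "real^4"
    have "smooth_on I (\<lambda>t. lorentz b (a t) *\<^sub>R u t + (- lorentz b (u t)) *\<^sub>R a t)"
      by (intro smooth_on_add smooth_on_minus smooth_on_scaleR smooth_on_lorentz smooth_on_const assms)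
    from smooth_on_continuous_on[OF assms(1) this]
    show "continuous_on I (\<lambda>t. A t b)"
      by (simp add: A fermi_walker_def)
  qed
  from linear_ode_solution[OF assms(1-3) this, of w0]
  obtain w where w: "w t0 = w0"
    "\<And>t. t \<in> I \<Longrightarrow> (w has_vector_derivative fermi_walker (u t) (a t) (w t)) (at t)"
    unfolding A by blast
  have "smooth_on I w"
  proof (rule smooth_on_self_derivative[OF assms(1) w(2)])
    fix n assume n: "diff_upto n I w"
    have ua: "diff_upto n I u" "diff_upto n I a"
      using assms by (auto simp: smooth_on_iff_diff_upto)
    note bil = diff_upto_bounded_bilinear
    have "diff_upto n I (\<lambda>t. lorentz (w t) (a t) *\<^sub>R u t + - (lorentz (w t) (u t) *\<^sub>R a t))"
      by (intro diff_upto_add bil[OF bounded_bilinear_scaleR] bil[OF bounded_bilinear_lorentz]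
          diff_upto_bounded_linear[OF bounded_linear_minus[OF bounded_linear_ident]] ua n)
    then show "diff_upto n I (\<lambda>t. fermi_walker (u t) (a t) (w t))"
      by (simp add: fermi_walker_def)
  qed
  with w show ?thesis using that by blast
qed

text \<open>The generator is skew, so the two contributions to the derivative of the product cancel.\<close>
lemma fermi_walker_lorentz_constant:
  assumes "open I" "is_interval I" "t \<in> I" "t0 \<in> I"
    and "\<And>t. t \<in> I \<Longrightarrow> (v has_vector_derivative fermi_walker (u t) (a t) (v t)) (at t)"
    and "\<And>t. t \<in> I \<Longrightarrow> (w has_vector_derivative fermi_walker (u t) (a t) (w t)) (at t)"
  shows "lorentz (v t) (w t) = lorentz (v t0) (w t0)"
proof (rule has_derivative_zero_unique[OF _ _ assms(3,4), where f = "\<lambda>t. lorentz (v t) (w t)"])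
  show "convex I" using assms(2) by (rule is_interval_convex)
  fix s assume s: "s \<in> I"
  have "((\<lambda>t. lorentz (v t) (w t)) has_vector_derivative 0) (at s)"
    using has_vector_derivative_lorentz[OF assms(5,6)[OF s]]
    by (simp add: fermi_walker_def lorentz_simps lorentz_commute)
  then show "((\<lambda>t. lorentz (v t) (w t)) has_derivative (\<lambda>h. 0)) (at s within I)"
    by (auto simp: has_vector_derivative_def intro: has_derivative_at_withinI)
qed

lemma smooth_on_tangent:
  assumes "open I" "timelike_curve I \<gamma>"
  shows "smooth_on I (tangent \<gamma>)"
  using smooth_on_vector_derivative[of I \<gamma>] assms
  by (simp add: timelike_curve_def tangent_def[abs_def])

text \<open>Fermi-Walker transport of an orthonormal basis given at one point. The velocity is itself
transported, because \<open>\<langle>T, T\<rangle> = -1\<close> and \<open>\<langle>T, T'\<rangle> = 0\<close>. So the other vectors stay orthogonal to it,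
and for a vector orthogonal to \<open>T\<close> the transport equation reduces to \<open>w' = \<langle>w, T'\<rangle> T\<close>.\<close>
lemma exists_parallel_frame:
  assumes "open I" "is_interval I" "timelike_curve I \<gamma>" "proper_time I \<gamma>" "t0 \<in> I"
    and E: "lorentz_orthonormal z" "z $ 1 = tangent \<gamma> t0"
  obtains P where "orthonormal_frame I \<gamma> P"
    "\<And>t i. t \<in> I \<Longrightarrow> i \<noteq> 1 \<Longrightarrow> \<exists>c. vector_derivative P (at t) $ i = c *\<^sub>R P t $ 1"
proof -
  let ?T = "tangent \<gamma>" and ?A = "\<lambda>t. vector_derivative (tangent \<gamma>) (at t)"
  have T: "smooth_on I ?T" by (intro smooth_on_tangent assms)
  then have A: "smooth_on I ?A" by (intro smooth_on_vector_derivative assms)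
  note dT = smooth_on_has_vector_derivative[OF assms(1) T]
  have TT: "lorentz (?T t) (?T t) = -1" if "t \<in> I" for t
    using assms(4) that by (auto simp: proper_time_def)
  have TA: "lorentz (?T t) (?A t) = 0" if t: "t \<in> I" for t
  proof -
    have "((\<lambda>s. lorentz (?T s) (?T s)) has_vector_derivative 0) (at t)"
      by (subst has_vector_derivative_cong_open[OF assms(1) t TT]) simp_all
    from vector_derivative_unique_at[OF has_vector_derivative_lorentz[OF dT[OF t] dT[OF t]] this]
    show ?thesis by (simp add: lorentz_commute)
  qed
  have "\<exists>w. w t0 = z $ i \<and> smooth_on I w \<and>
      (\<forall>t\<in>I. (w has_vector_derivative fermi_walker (?T t) (?A t) (w t)) (at t))" for i
    using fermi_walker_transport[OF assms(1,2,5) T A] by metis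
  then obtain W where W: "\<And>i. W i t0 = z $ i" "\<And>i. smooth_on I (W i)"
    "\<And>i t. t \<in> I \<Longrightarrow> (W i has_vector_derivative fermi_walker (?T t) (?A t) (W i t)) (at t)"
    by metis
  have dT': "(?T has_vector_derivative fermi_walker (?T t) (?A t) (?T t)) (at t)" if "t \<in> I" for t
    using dT[OF that] by (simp add: fermi_walker_def TT[OF that] TA[OF that])
  define P where "P t = (\<chi> i. if i = 1 then ?T t else W i t)" for t
  have dP: "((\<lambda>s. P s $ i) has_vector_derivative fermi_walker (?T t) (?A t) (P t $ i)) (at t)"
    if "t \<in> I" for i t
    using W(3)[OF that] dT'[OF that] by (simp add: P_def)
  have "P t0 = z" using E(2) by (simp add: P_def W(1) vec_eq_iff)
  then have orth: "lorentz_orthonormal (P t)" if "t \<in> I" for t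
    using fermi_walker_lorentz_constant[OF assms(1,2) that assms(5) dP dP] E(1)
    by (simp add: lorentz_orthonormal_def)
  have smP: "smooth_on I P"
  proof (rule smooth_on_vec[OF assms(1)])
    show "smooth_on I (\<lambda>t. P t $ i)" for i
      by (cases "i = 1") (simp_all add: P_def W(2) T)
  qed
  have "\<exists>c. vector_derivative P (at t) $ i = c *\<^sub>R P t $ 1" if t: "t \<in> I" and i: "i \<noteq> 1" for t i
  proof -
    have "vector_derivative P (at t) $ i = fermi_walker (?T t) (?A t) (P t $ i)"
      by (rule vector_derivative_unique_at[OF has_vector_derivative_vec_nth dP[OF t]])
        (rule smooth_on_has_vector_derivative[OF assms(1) smP t])
    moreover have "lorentz (P t $ i) (P t $ 1) = 0"
      using orth[OF t] i by (simp add: lorentz_orthonormal_def)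
    ultimately show ?thesis by (auto simp: fermi_walker_def P_def)
  qed
  moreover have "orthonormal_frame I \<gamma> P"
    using smP orth by (auto simp: orthonormal_frame_iff[OF assms(4)] P_def)
  ultimately show ?thesis using that by blast
qed

lemma admits_type_B:
  assumes "open I" "proper_time I \<gamma>" "orthonormal_frame I \<gamma> P"
    and P': "\<And>t i. t \<in> I \<Longrightarrow> i \<noteq> 1 \<Longrightarrow> \<exists>c. vector_derivative P (at t) $ i = c *\<^sub>R P t $ 1"
  shows "admits_bishop_frame form_B I \<gamma>"
proof -
  have "connection_coeff P i j t = 0" if "t \<in> I" "i \<noteq> 1" "j \<noteq> 1" for t i j
  proof -
    have "lorentz_orthonormal (P t)"
      using assms(2,3) that by (auto simp: orthonormal_frame_iff)
    then show ?thesis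
      using P'[OF that(1,2)] that(3)
      by (auto simp: connection_coeff_def lorentz_simps lorentz_orthonormal_def)
  qed
  then show ?thesis
    unfolding admits_bishop_frame_def by (intro exI[of _ P] bishop_frameI(1) assms) auto
qed

section \<open>Type C\<close>

text \<open>The lines spanned by the points of a differentiable curve sweep out the image of a two-dimensional
domain under a differentiable map, which is negligible in three-space.\<close>
lemma exists_direction_off_curve:
  fixes k :: "real \<Rightarrow> real^3"
  assumes "\<And>t. t \<in> I \<Longrightarrow> k differentiable (at t)" and "t0 \<in> I"
  obtains c where "norm c = 1" "\<And>s t. t \<in> I \<Longrightarrow> c \<noteq> s *\<^sub>R k t"
proof -
  let ?f = "\<lambda>p :: real \<times> real. fst p *\<^sub>R k (snd p)"
  have "?f differentiable_on UNIV \<times> I"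
    unfolding differentiable_on_def
  proof
    fix p :: "real \<times> real" assume "p \<in> UNIV \<times> I"
    then have "k differentiable (at (snd p))" using assms(1) by auto
    then have "(\<lambda>p. k (snd p)) differentiable (at p within UNIV \<times> I)"
      by (intro differentiable_compose[of k snd]) (auto intro: bounded_linear_imp_differentiable bounded_linear_snd)
    then show "?f differentiable (at p within UNIV \<times> I)"
      by (intro differentiable_scaleR) (auto intro: bounded_linear_imp_differentiable bounded_linear_fst)
  qed
  then have "negligible (?f ` (UNIV \<times> I))"
    by (intro negligible_differentiable_image_lowdim) simp_all
  then have "?f ` (UNIV \<times> I) \<noteq> UNIV"
    using non_negligible_UNIV by metis
  then obtain c where c: "c \<notin> ?f ` (UNIV \<times> I)" by blast
  have c': "c \<noteq> s *\<^sub>R k t" if "t \<in> I" for s t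
    using c that by (auto simp: image_iff)
  from c'[OF assms(2), of 0] have "c \<noteq> 0" by simp
  show ?thesis
  proof (rule that[of "c /\<^sub>R norm c"])
    show "norm (c /\<^sub>R norm c) = 1" using \<open>c \<noteq> 0\<close> by simp
    show "c /\<^sub>R norm c \<noteq> s *\<^sub>R k t" if "t \<in> I" for s t
    proof
      assume "c /\<^sub>R norm c = s *\<^sub>R k t"
      then have "norm c *\<^sub>R (c /\<^sub>R norm c) = (norm c * s) *\<^sub>R k t" by simp
      with \<open>c \<noteq> 0\<close> c'[OF that] show False by simp
    qed
  qed
qed

text \<open>Any vector \<open>spatial P c\<close> with constant coordinates in a parallel frame has a derivative proportional
to \<open>T\<close>; taken as the third frame vector it makes the coefficients \<open>(2,3)\<close> and \<open>(3,4)\<close> vanish.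
The remaining condition is that the fourth vector be orthogonal to \<open>T'\<close>. If \<open>k\<close> denotes the
coordinates of \<open>T'\<close>, the unit vector along \<open>k \<times> c\<close> qualifies, provided that \<open>k \<times> c\<close> has no zero.
This is where 2-regularity enters: it gives \<open>k \<noteq> 0\<close>, and then it suffices that \<open>c\<close> avoids all
the lines spanned by the values of \<open>k\<close>.\<close>
lemma admits_type_C:
  assumes "open I" "proper_time I \<gamma>" "two_regular I \<gamma>" "t0 \<in> I" "orthonormal_frame I \<gamma> P"
    and P': "\<And>t i. t \<in> I \<Longrightarrow> i \<noteq> 1 \<Longrightarrow> \<exists>c. vector_derivative P (at t) $ i = c *\<^sub>R P t $ 1"
  shows "admits_bishop_frame form_C I \<gamma>"
proof -
  have P: "smooth_on I P" "\<And>t. t \<in> I \<Longrightarrow> P t $ 1 = tangent \<gamma> t" "\<And>t. t \<in> I \<Longrightarrow> lorentz_orthonormal (P t)"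
    using assms(2,5) by (auto simp: orthonormal_frame_iff)
  define k :: "real \<Rightarrow> real^3" where
    "k t = vector [connection_coeff P 1 2 t, connection_coeff P 1 3 t, connection_coeff P 1 4 t]" for t
  have smk: "smooth_on I k"
  proof (rule smooth_on_vec[OF assms(1)])
    show "smooth_on I (\<lambda>t. k t $ i)" for i
      using exhaust_3[of i] smooth_on_connection_coeff[OF assms(1) P(1)]
      by (auto simp: k_def)
  qed
  have k0: "k t \<noteq> 0" if t: "t \<in> I" for t
  proof
    assume "k t = 0"
    with tangent_derivative_spatial[OF assms(1,2,5) t]
    have "vector_derivative P (at t) $ 1 = 0"
      by (simp add: k_def[symmetric] spatial_def)
    with has_vector_derivative_vec_nth[OF smooth_on_has_vector_derivative[OF assms(1) P(1) t], of 1]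
    have "(tangent \<gamma> has_vector_derivative 0) (at t)"
      using has_vector_derivative_cong_open[OF assms(1) t P(2)] by simp
    with assms(3) t show False
      by (auto simp: two_regular_def dest: vector_derivative_at)
  qed
  obtain c where c: "norm c = 1" "\<And>s t. t \<in> I \<Longrightarrow> c \<noteq> s *\<^sub>R k t"
    using exists_direction_off_curve[OF
        differentiableI_vector[OF smooth_on_has_vector_derivative[OF assms(1) smk]] assms(4)]
    by blast
  have nz: "cross3 (k t) c \<noteq> 0" if "t \<in> I" for t
    using c(1) c(2)[OF that] k0[OF that] by (auto simp: cross_eq_0 collinear_lemma)
  define n where "n t = inverse (sqrt (cross3 (k t) c \<bullet> cross3 (k t) c)) *\<^sub>R cross3 (k t) c" for t
  have bil: "bounded_bilinear cross3"
    using bilinear_cross by (simp add: bilinear_conv_bounded_bilinear)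
  note smooth_cross = smooth_on_bounded_bilinear[OF bil assms(1)]
  have smc: "smooth_on I (\<lambda>t. cross3 (k t) c)"
    by (intro smooth_cross smk smooth_on_const assms)
  have smn: "smooth_on I n"
    unfolding n_def[abs_def]
    by (intro smooth_on_scaleR smooth_on_inverse smooth_on_sqrt smooth_on_inner smc assms)
      (use nz in auto)
  have nn: "n t \<bullet> n t = 1" if "t \<in> I" for t
  proof -
    have "cross3 (k t) c \<bullet> cross3 (k t) c > 0" using nz[OF that] by simp
    then show ?thesis by (simp add: n_def field_simps)
  qed
  have nc: "n t \<bullet> c = 0" "n t \<bullet> k t = 0" for t
    by (simp_all add: n_def dot_cross_self)
  have cc: "c \<bullet> c = 1" using c(1) by (simp add: norm_eq_1)
  define R :: "real \<Rightarrow> real^3^3" where "R t = vector [cross3 (n t) c, c, n t]" for t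
  have "smooth_on I (\<lambda>t. R t $ i)" for i
    using exhaust_3[of i] smooth_cross[OF smn smooth_on_const[OF assms(1)]] smooth_on_const[OF assms(1)] smn
    by (auto simp: R_def)
  then have smR: "smooth_on I R" by (rule smooth_on_vec[OF assms(1)])
  have R_orth: "R t $ i \<bullet> R t $ j = (if i = j then 1 else 0)" if "t \<in> I" for t i j
  proof -
    have "cross3 (n t) c \<bullet> cross3 (n t) c = 1"
      using norm_cross_dot[of "n t" c] nn[OF that] nc(1)[of t] cc
      by (simp add: norm_eq_sqrt_inner)
    then show ?thesis
      using exhaust_3[of i] exhaust_3[of j] nn[OF that] nc(1)[of t] cc
      by (auto simp: R_def dot_cross_self inner_commute)
  qed
  have Z: "orthonormal_frame I \<gamma> (\<lambda>t. rotate_frame (P t) (R t))"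
    by (intro orthonormal_frame_rotate assms smR R_orth)
  let ?Z = "\<lambda>t. rotate_frame (P t) (R t)"
  from Z have Z': "smooth_on I ?Z" "\<And>t. t \<in> I \<Longrightarrow> lorentz_orthonormal (?Z t)"
    by (auto simp: orthonormal_frame_iff[OF assms(2)])
  have "connection_coeff ?Z 1 4 t = 0 \<and> connection_coeff ?Z 2 3 t = 0 \<and> connection_coeff ?Z 3 4 t = 0"
    if t: "t \<in> I" for t
  proof -
    have "connection_coeff ?Z 1 4 t = k t \<bullet> R t $ 3"
      unfolding k_def by (rule connection_coeff_rotate_tangent[OF assms(1,2,5) t Z'(1) rotate_frame_nth(4)])
    then have "connection_coeff ?Z 1 4 t = 0" using nc by (simp add: R_def inner_commute)
    moreover have "connection_coeff ?Z 3 j t = 0" if j: "\<And>z r. rotate_frame z r $ j = spatial z (r $ l)" for j l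
    proof -
      have "((\<lambda>t. R t $ 2) has_vector_derivative 0) (at t)" by (simp add: R_def)
      from connection_coeff_rotate_spatial[OF assms(1,2,5) t Z'(1) rotate_frame_nth(3) j this]
      have "connection_coeff ?Z 3 j t =
          lorentz (spatial (vector_derivative P (at t)) c) (spatial (P t) (R t $ l))"
        by (simp add: R_def)
      moreover obtain a where "\<And>i. i \<noteq> 1 \<Longrightarrow> vector_derivative P (at t) $ i = a i *\<^sub>R P t $ 1"
        using P'[OF t] by metis
      then have "spatial (vector_derivative P (at t)) c =
          (c $ 1 * a 2 + c $ 2 * a 3 + c $ 3 * a 4) *\<^sub>R P t $ 1"
        by (simp add: spatial_def scaleR_add_left)
      ultimately show ?thesis by (simp add: lorentz_simps lorentz_spatial[OF P(3)[OF t]])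
    qed
    from this[OF rotate_frame_nth(2)] this[OF rotate_frame_nth(4)]
    have "connection_coeff ?Z 3 2 t = 0" "connection_coeff ?Z 3 4 t = 0" .
    ultimately show ?thesis
      using connection_coeff_antisym[OF assms(1) Z'(1) t Z'(2), of 2 3] by simp
  qed
  from bishop_frameI(2)[OF assms(1,2) Z this] show ?thesis
    unfolding admits_bishop_frame_def by blast
qed

section \<open>The implications\<close>

text \<open>An empty domain offers no point at which a transport could start; there every condition is vacuous.\<close>
lemma admits_bishop_frame_empty: "admits_bishop_frame form {} \<gamma>"
  using exI[where P = "\<lambda>p. p permutes {2, 3, 4 :: 4}", OF permutes_id]
  by (auto simp: admits_bishop_frame_def bishop_frame_def orthonormal_frame_def
      smooth_on_def coefficient_matrix_def)

theorem corollary1p5: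
  fixes I :: "real set" and \<gamma> :: "real \<Rightarrow> real^4"
  assumes "open I" and "is_interval I"
    and "timelike_curve I \<gamma>" and "proper_time I \<gamma>" and "two_regular I \<gamma>"
  shows "(admits_bishop_frame form_F I \<gamma> \<longrightarrow>
            admits_bishop_frame form_B I \<gamma> \<and>
            admits_bishop_frame form_C I \<gamma> \<and>
            admits_bishop_frame form_D I \<gamma>) \<and>
         (admits_frenet_frame I \<gamma> \<longrightarrow>
            admits_bishop_frame form_B I \<gamma> \<and>
            admits_bishop_frame form_C I \<gamma> \<and>
            admits_bishop_frame form_D I \<gamma>)"
proof -
  have main: "admits_bishop_frame form_B I \<gamma> \<and> admits_bishop_frame form_C I \<gamma> \<and>
      admits_bishop_frame form_D I \<gamma>" if F: "admits_bishop_frame form_F I \<gamma>"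
  proof (cases "I = {}")
    case True
    then show ?thesis by (simp add: admits_bishop_frame_empty)
  next
    case False
    then obtain t0 where t0: "t0 \<in> I" by blast
    obtain E x1 x2 x3 where E: "orthonormal_frame I \<gamma> E" "smooth_on I x3"
      "coefficient_matrix I E (\<lambda>t. form_F (x1 t) (x2 t) (x3 t))"
      using admits_type_F_in_displayed_order[OF assms(1,4) F] by blast
    from E(1) t0 have "lorentz_orthonormal (E t0)" "E t0 $ 1 = tangent \<gamma> t0"
      by (auto simp: orthonormal_frame_iff[OF assms(4)])
    from exists_parallel_frame[OF assms(1-4) t0 this] obtain P where P: "orthonormal_frame I \<gamma> P"
      "\<And>t i. t \<in> I \<Longrightarrow> i \<noteq> 1 \<Longrightarrow> \<exists>c. vector_derivative P (at t) $ i = c *\<^sub>R P t $ 1" by blast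
    show ?thesis
      using admits_type_B[OF assms(1,4) P] admits_type_C[OF assms(1,4,5) t0 P]
        admits_type_D[OF assms(1,2,4) t0 E] by blast
  qed
  moreover have "admits_bishop_frame form_F I \<gamma>" if "admits_frenet_frame I \<gamma>"
  proof -
    from that obtain Z x1 x2 x3 where "orthonormal_frame I \<gamma> Z" "smooth_on I x1" "smooth_on I x2"
      "smooth_on I x3" "coefficient_matrix I Z (\<lambda>t. form_F (x1 t) (x2 t) (x3 t))"
      unfolding admits_frenet_frame_def frenet_frame_def by blast
    moreover from this have "coefficient_matrix I (\<lambda>t. \<chi> i. Z t $ id i) (\<lambda>t. form_F (x1 t) (x2 t) (x3 t))"
      by simp
    ultimately show ?thesis
      unfolding admits_bishop_frame_def bishop_frame_def
      using permutes_id[of "{2, 3, 4 :: 4}"] by blast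
  qed
  ultimately show ?thesis by blast
qed

end
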